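(* Let $\mathbb{F}$ be a field with $\mathrm{Char}(\mathbb{F})\neq 2,3$ in which every quadratic and every cubic polynomial has a root. Nontrivial two-dimensional algebras over $\mathbb{F}$ are distributed with respect to the number of their nontrivial (that is, one-dimensional) subalgebras as follows (families $A_1,\dots,A_{12}$ as in the context; parameters range over $\mathbb{F}$). (1) Any nontrivial two-dimensional algebra with only one nontrivial subalgebra is isomorphic to one of: - $A_1(\alpha_1,\alpha_2,\alpha_4,\beta_1)$, where $\alpha_4\neq 0$, $\alpha_1=\frac{(3\alpha_2+1)^2}{9\alpha_4}+\frac13$, $\beta_1=\frac{-(3\alpha_2+1)^3}{27\alpha_4^2}$; - $A_1(\frac13,-\frac13,0,\beta_1)$, where $\beta_1\neq 0$; - $A_2(\alpha_1,0,2\alpha_1-1)$; - $A_5(\alpha_1)$; - $A_6(\frac13,0)$; - $A_9$; - $A_{12}$. (2) Any nontrivial two-dimensional algebra with exactly two nontrivial subalgebras is isomorphic to one of: - $A_1(\alpha_1,\alpha_2,\alpha_4,\beta_1)$, where $\alpha_4\neq 0$, $\alpha_1\neq\frac{(3\alpha_2+1)^2}{9\alpha_4}+\frac13$, and $p_{A_1}(y_{-1})\,p_{A_1}(y_{+1})=0$ with $y_{\pm1}=\frac{-(3\alpha_2+1)\pm\sqrt{(3\alpha_2+1)^2-3\alpha_4(3\alpha_1-1)}}{3\alpha_4}$; - $A_1(\alpha_1,\alpha_2,0,\beta_1)$, where $\alpha_2\neq-\frac13$ and $(3\alpha_1-1)^2+4(3\alpha_2+1)\beta_1=0$; - $A_1(\alpha_1,-\frac13,0,\beta_1)$,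 where $\alpha_1\neq\frac13$; - $A_2(\alpha_1,\beta_1,\beta_2)$, where $\beta_2\neq2\alpha_1-1$ and $p_{A_2}(y_{-2})\,p_{A_2}(y_{+2})=0$ with $y_{\pm2}=\pm\frac{\sqrt{3(1+\beta_2-2\alpha_1)}}{3}$; - $A_3(-\frac{(\beta_2+1)^2}{12},\beta_2)$; - $A_4(\alpha_1,\beta_2)$, where $\beta_2\neq2\alpha_1-1$; - $A_6(\alpha_1,\beta_1)$, where $\alpha_1\neq\frac13$ and $p_{A_6}(y_{-6})\,p_{A_6}(y_{+6})=0$ with $y_{-6}=\frac{\sqrt{3(1-3\alpha_1)}}{3}$, $y_{+6}=-\frac{\sqrt{3(1-3\alpha_1)}}{3}$; - $A_7(-\frac1{12})$; - $A_8(\alpha_1)$, where $\alpha_1\neq\frac13$; - $A_{10}$. (3) Any nontrivial two-dimensional algebra with exactly three nontrivial subalgebras is isomorphic to one of: - $A_1(\alpha_1,\alpha_2,\alpha_4,\beta_1)$, where $\alpha_4\neq0$ and $p_{A_1}(y_{-1})\,p_{A_1}(y_{+1})\neq0$ (with $y_{\pm1}$ given by the formula in (2)); - $A_1(\alpha_1,\alpha_2,0,\beta_1)$, where $(3\alpha_2+1)\big((3\alpha_1-1)^2+4(3\alpha_2+1)\beta_1\big)\neq0$; - $A_2(\alpha_1,\beta_1,\beta_2)$, where $p_{A_2}(y_{-2})\,p_{A_2}(y_{+2})\neq0$; - $A_3(\beta_1,\beta_2)$, where $(\beta_2+1)^2+12\beta_1\neq0$; - $A_6(\alpha_1,\beta_1)$,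 where $p_{A_6}(y_{-6})\,p_{A_6}(y_{+6})\neq0$; - $A_7(\beta_1)$, where $12\beta_1+1\neq0$; - $A_{11}$. (4) Any nontrivial two-dimensional algebra with infinitely many nontrivial subalgebras is isomorphic to one of: - $A_1(\frac13,-\frac13,0,0)$; - $A_4(\alpha_1,2\alpha_1-1)$; - $A_8(\frac13)$.
   Context: An algebra is a vector space with a bilinear product (not necessarily associative, commutative or unital); it is nontrivial if its product is not identically zero. A nontrivial subalgebra of a two-dimensional algebra is a one-dimensional one. A two-dimensional algebra with basis $e_1,e_2$ is identified with its matrix of structure constants (MSC) $A=\begin{pmatrix}\alpha_1&\alpha_2&\alpha_3&\alpha_4\\ \beta_1&\beta_2&\beta_3&\beta_4\end{pmatrix}$, meaning $e_1e_1=\alpha_1e_1+\beta_1e_2$, $e_1e_2=\alpha_2e_1+\beta_2e_2$, $e_2e_1=\alpha_3e_1+\beta_3e_2$, $e_2e_2=\alpha_4e_1+\beta_4e_2$. For such $A$ put $p_A(y)=\alpha_4y^3+(\alpha_2+\alpha_3-\beta_4)y^2+(\alpha_1-\beta_2-\beta_3)y-\beta_1$; in particular $p_{A_1}(y)=\alpha_4y^3+(3\alpha_2+1)y^2+(3\alpha_1-1)y-\beta_1$, $p_{A_2}(y)=y^3+(2\alpha_1-\beta_2-1)y-\beta_1$, $p_{A_6}(y)=y^3+(3\alpha_1-1)y-\beta_1$. $\sqrt{z}$ denotes a chosen square root of $z$ in $\mathbb{F}$. Families ($\mathrm{Char}(\mathbb{F})\ne2,3$): $A_1(\alpha_1,\alpha_2,\alpha_4,\beta_1)=\begin{pmatrix}\alpha_1&\alpha_2&\alpha_2+1&\alpha_4\\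 \beta_1&-\alpha_1&-\alpha_1+1&-\alpha_2\end{pmatrix}$, $A_2(\alpha_1,\beta_1,\beta_2)=\begin{pmatrix}\alpha_1&0&0&1\\ \beta_1&\beta_2&1-\alpha_1&0\end{pmatrix}$, $A_3(\beta_1,\beta_2)=\begin{pmatrix}0&1&1&0\\ \beta_1&\beta_2&1&-1\end{pmatrix}$, $A_4(\alpha_1,\beta_2)=\begin{pmatrix}\alpha_1&0&0&0\\ 0&\beta_2&1-\alpha_1&0\end{pmatrix}$, $A_5(\alpha_1)=\begin{pmatrix}\alpha_1&0&0&0\\ 1&2\alpha_1-1&1-\alpha_1&0\end{pmatrix}$, $A_6(\alpha_1,\beta_1)=\begin{pmatrix}\alpha_1&0&0&1\\ \beta_1&1-\alpha_1&-\alpha_1&0\end{pmatrix}$, $A_7(\beta_1)=\begin{pmatrix}0&1&1&0\\ \beta_1&1&0&-1\end{pmatrix}$, $A_8(\alpha_1)=\begin{pmatrix}\alpha_1&0&0&0\\ 0&1-\alpha_1&-\alpha_1&0\end{pmatrix}$, $A_9=\begin{pmatrix}\frac13&0&0&0\\ 1&\frac23&-\frac13&0\end{pmatrix}$, $A_{10}=\begin{pmatrix}0&1&1&0\\ 0&0&0&-1\end{pmatrix}$, $A_{11}=\begin{pmatrix}0&1&1&0\\ 1&0&0&-1\end{pmatrix}$, $A_{12}=\begin{pmatrix}0&0&0&0\\ 1&0&0&0\end{pmatrix}$. *)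

theory Defs
  imports "HOL-Analysis.Analysis"
begin

section \<open>Algebras over a field\<close>

locale nonassoc_algebra = vector_space smul
  for smul :: "'a::field \<Rightarrow> 'v::ab_group_add \<Rightarrow> 'v" +
  fixes mul :: "'v \<Rightarrow> 'v \<Rightarrow> 'v"
  assumes linear_mul_left: "Vector_Spaces.linear smul smul (\<lambda>x. mul x y)"
    and linear_mul_right: "Vector_Spaces.linear smul smul (\<lambda>y. mul x y)"
begin

definition subalgebra :: "'v set \<Rightarrow> bool" where
  "subalgebra W \<longleftrightarrow> subspace W \<and> (\<forall>x\<in>W. \<forall>y\<in>W. mul x y \<in> W)"

definition nontrivial :: bool where
  "nontrivial \<longleftrightarrow> (\<exists>x y. mul x y \<noteq> 0)"

end

locale two_dim_algebra = nonassoc_algebra +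
  assumes dim_UNIV: "dim UNIV = 2"
begin

definition nontrivial_subalgebras :: "'b set set" where
  "nontrivial_subalgebras = {W. subalgebra W \<and> dim W = 1}"

end

definition algebra_isomorphic ::
  "('a::field \<Rightarrow> 'v::ab_group_add \<Rightarrow> 'v) \<Rightarrow> ('v \<Rightarrow> 'v \<Rightarrow> 'v) \<Rightarrow>
   ('a \<Rightarrow> 'w::ab_group_add \<Rightarrow> 'w) \<Rightarrow> ('w \<Rightarrow> 'w \<Rightarrow> 'w) \<Rightarrow> bool" where
  "algebra_isomorphic s1 m1 s2 m2 \<longleftrightarrow>
     (\<exists>f. Vector_Spaces.linear s1 s2 f \<and> bij f \<and> (\<forall>x y. f (m1 x y) = m2 (f x) (f y)))"


section \<open>Matrices of structure constants\<close>

definition msc :: "'a \<Rightarrow> 'a \<Rightarrow> 'a \<Rightarrow> 'a \<Rightarrow> 'a \<Rightarrow> 'a \<Rightarrow> 'a \<Rightarrow> 'a \<Rightarrow> 'a::field^4^2" where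
  "msc \<alpha>1 \<alpha>2 \<alpha>3 \<alpha>4 \<beta>1 \<beta>2 \<beta>3 \<beta>4 = vector [vector [\<alpha>1, \<alpha>2, \<alpha>3, \<alpha>4], vector [\<beta>1, \<beta>2, \<beta>3, \<beta>4]]"

text \<open>The product on the coordinate plane is the matrix applied to the Kronecker product of the
  two coordinate vectors.\<close>

definition msc_mul :: "'a::field^4^2 \<Rightarrow> 'a^2 \<Rightarrow> 'a^2 \<Rightarrow> 'a^2" where
  "msc_mul A x y = A *v vector [x$1 * y$1, x$1 * y$2, x$2 * y$1, x$2 * y$2]"

lemma vector_4:
  "(vector [a, b, c, d] :: 'a::zero^4) $ 1 = a"
  "(vector [a, b, c, d] :: 'a::zero^4) $ 2 = b"
  "(vector [a, b, c, d] :: 'a::zero^4) $ 3 = c"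
  "(vector [a, b, c, d] :: 'a::zero^4) $ 4 = d"
  unfolding vector_def by auto

lemma msc_mul_basis:
  fixes \<alpha>1 \<alpha>2 \<alpha>3 \<alpha>4 \<beta>1 \<beta>2 \<beta>3 \<beta>4 :: "'a::field"
  defines "A \<equiv> msc \<alpha>1 \<alpha>2 \<alpha>3 \<alpha>4 \<beta>1 \<beta>2 \<beta>3 \<beta>4"
    and "e1 \<equiv> vector [1, 0]" and "e2 \<equiv> vector [0, 1]"
  shows "msc_mul A e1 e1 = \<alpha>1 *s e1 + \<beta>1 *s e2"
    and "msc_mul A e1 e2 = \<alpha>2 *s e1 + \<beta>2 *s e2"
    and "msc_mul A e2 e1 = \<alpha>3 *s e1 + \<beta>3 *s e2"
    and "msc_mul A e2 e2 = \<alpha>4 *s e1 + \<beta>4 *s e2"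
  by (simp_all add: assms msc_mul_def msc_def vec_eq_iff forall_2 matrix_vector_mult_def
      sum_4 vector_4)

lemma two_dim_algebra_msc: "two_dim_algebra (*s) (msc_mul A)"
proof unfold_locales
  show "vec.dim (UNIV :: ('a^2) set) = 2"
    by (simp add: vec.dim_UNIV card_cart_basis)
qed (simp_all add: msc_mul_def vec_eq_iff matrix_vector_mult_def sum_4 vector_4 algebra_simps)

text \<open>The line spanned by \<open>e1 + y e2\<close> is a subalgebra exactly if \<open>msc_cubic A y = 0\<close>; the remaining
  line, spanned by \<open>e2\<close>, is one exactly if the leading coefficient vanishes.\<close>

definition msc_cubic :: "'a::field^4^2 \<Rightarrow> 'a \<Rightarrow> 'a" where
  "msc_cubic A y = A$1$4 * y^3 + (A$1$2 + A$1$3 - A$2$4) * y^2 + (A$1$1 - A$2$2 - A$2$3) * y - A$2$1"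


section \<open>The families\<close>

definition A1 :: "'a \<Rightarrow> 'a \<Rightarrow> 'a \<Rightarrow> 'a \<Rightarrow> 'a::field^4^2" where
  "A1 \<alpha>1 \<alpha>2 \<alpha>4 \<beta>1 = msc \<alpha>1 \<alpha>2 (\<alpha>2 + 1) \<alpha>4
                         \<beta>1 (- \<alpha>1) (- \<alpha>1 + 1) (- \<alpha>2)"

definition A2 :: "'a \<Rightarrow> 'a \<Rightarrow> 'a \<Rightarrow> 'a::field^4^2" where
  "A2 \<alpha>1 \<beta>1 \<beta>2 = msc \<alpha>1 0 0 1
                      \<beta>1 \<beta>2 (1 - \<alpha>1) 0"

definition A3 :: "'a \<Rightarrow> 'a \<Rightarrow> 'a::field^4^2" where
  "A3 \<beta>1 \<beta>2 = msc 0 1 1 0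
                   \<beta>1 \<beta>2 1 (- 1)"

definition A4 :: "'a \<Rightarrow> 'a \<Rightarrow> 'a::field^4^2" where
  "A4 \<alpha>1 \<beta>2 = msc \<alpha>1 0 0 0
                   0 \<beta>2 (1 - \<alpha>1) 0"

definition A5 :: "'a \<Rightarrow> 'a::field^4^2" where
  "A5 \<alpha>1 = msc \<alpha>1 0 0 0
                1 (2 * \<alpha>1 - 1) (1 - \<alpha>1) 0"

definition A6 :: "'a \<Rightarrow> 'a \<Rightarrow> 'a::field^4^2" where
  "A6 \<alpha>1 \<beta>1 = msc \<alpha>1 0 0 1
                   \<beta>1 (1 - \<alpha>1) (- \<alpha>1) 0"

definition A7 :: "'a \<Rightarrow> 'a::field^4^2" where
  "A7 \<beta>1 = msc 0 1 1 0
                \<beta>1 1 0 (- 1)"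

definition A8 :: "'a \<Rightarrow> 'a::field^4^2" where
  "A8 \<alpha>1 = msc \<alpha>1 0 0 0
                0 (1 - \<alpha>1) (- \<alpha>1) 0"

definition A9 :: "'a::field^4^2" where
  "A9 = msc (1/3) 0 0 0
            1 (2/3) (- (1/3)) 0"

definition A10 :: "'a::field^4^2" where
  "A10 = msc 0 1 1 0
             0 0 0 (- 1)"

definition A11 :: "'a::field^4^2" where
  "A11 = msc 0 1 1 0
             1 0 0 (- 1)"

definition A12 :: "'a::field^4^2" where
  "A12 = msc 0 0 0 0
             1 0 0 0"


section \<open>The numbers \<open>y\<close> at which the cubics are evaluated\<close>

text \<open>These are the zeros of the derivatives of the cubics of \<open>A1\<close>, \<open>A2\<close> and \<open>A6\<close> (when the leading
  coefficient is nonzero). The parameter \<open>rt\<close> is an arbitrary choice of square roots.\<close>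

definition y_m1 :: "('a::field \<Rightarrow> 'a) \<Rightarrow> 'a \<Rightarrow> 'a \<Rightarrow> 'a \<Rightarrow> 'a" where
  "y_m1 rt \<alpha>1 \<alpha>2 \<alpha>4 =
     (- (3*\<alpha>2 + 1) - rt ((3*\<alpha>2 + 1)^2 - 3*\<alpha>4*(3*\<alpha>1 - 1))) / (3*\<alpha>4)"

definition y_p1 :: "('a::field \<Rightarrow> 'a) \<Rightarrow> 'a \<Rightarrow> 'a \<Rightarrow> 'a \<Rightarrow> 'a" where
  "y_p1 rt \<alpha>1 \<alpha>2 \<alpha>4 =
     (- (3*\<alpha>2 + 1) + rt ((3*\<alpha>2 + 1)^2 - 3*\<alpha>4*(3*\<alpha>1 - 1))) / (3*\<alpha>4)"

definition y_m2 :: "('a::field \<Rightarrow> 'a) \<Rightarrow> 'a \<Rightarrow> 'a \<Rightarrow> 'a" where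
  "y_m2 rt \<alpha>1 \<beta>2 = - (rt (3*(1 + \<beta>2 - 2*\<alpha>1)) / 3)"

definition y_p2 :: "('a::field \<Rightarrow> 'a) \<Rightarrow> 'a \<Rightarrow> 'a \<Rightarrow> 'a" where
  "y_p2 rt \<alpha>1 \<beta>2 = rt (3*(1 + \<beta>2 - 2*\<alpha>1)) / 3"

definition y_m6 :: "('a::field \<Rightarrow> 'a) \<Rightarrow> 'a \<Rightarrow> 'a" where
  "y_m6 rt \<alpha>1 = rt (3*(1 - 3*\<alpha>1)) / 3"

definition y_p6 :: "('a::field \<Rightarrow> 'a) \<Rightarrow> 'a \<Rightarrow> 'a" where
  "y_p6 rt \<alpha>1 = - (rt (3*(1 - 3*\<alpha>1)) / 3)"


section \<open>The four lists\<close>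

definition one_list :: "('a::field^4^2) set" where
  "one_list =
     {A1 \<alpha>1 \<alpha>2 \<alpha>4 \<beta>1 | \<alpha>1 \<alpha>2 \<alpha>4 \<beta>1.
        \<alpha>4 \<noteq> 0 \<and> \<alpha>1 = (3*\<alpha>2 + 1)^2 / (9*\<alpha>4) + 1/3 \<and> \<beta>1 = - ((3*\<alpha>2 + 1)^3) / (27*\<alpha>4^2)}
   \<union> {A1 (1/3) (- (1/3)) 0 \<beta>1 | \<beta>1. \<beta>1 \<noteq> 0}
   \<union> {A2 \<alpha>1 0 (2*\<alpha>1 - 1) | \<alpha>1. True}
   \<union> {A5 \<alpha>1 | \<alpha>1. True}
   \<union> {A6 (1/3) 0}
   \<union> {A9}
   \<union> {A12}"

definition two_list :: "('a::field \<Rightarrow> 'a) \<Rightarrow> ('a^4^2) set" where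
  "two_list rt =
     {A1 \<alpha>1 \<alpha>2 \<alpha>4 \<beta>1 | \<alpha>1 \<alpha>2 \<alpha>4 \<beta>1.
        \<alpha>4 \<noteq> 0 \<and> \<alpha>1 \<noteq> (3*\<alpha>2 + 1)^2 / (9*\<alpha>4) + 1/3 \<and>
        msc_cubic (A1 \<alpha>1 \<alpha>2 \<alpha>4 \<beta>1) (y_m1 rt \<alpha>1 \<alpha>2 \<alpha>4) *
        msc_cubic (A1 \<alpha>1 \<alpha>2 \<alpha>4 \<beta>1) (y_p1 rt \<alpha>1 \<alpha>2 \<alpha>4) = 0}
   \<union> {A1 \<alpha>1 \<alpha>2 0 \<beta>1 | \<alpha>1 \<alpha>2 \<beta>1.
        \<alpha>2 \<noteq> - (1/3) \<and> (3*\<alpha>1 - 1)^2 + 4*(3*\<alpha>2 + 1)*\<beta>1 = 0}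
   \<union> {A1 \<alpha>1 (- (1/3)) 0 \<beta>1 | \<alpha>1 \<beta>1. \<alpha>1 \<noteq> 1/3}
   \<union> {A2 \<alpha>1 \<beta>1 \<beta>2 | \<alpha>1 \<beta>1 \<beta>2.
        \<beta>2 \<noteq> 2*\<alpha>1 - 1 \<and>
        msc_cubic (A2 \<alpha>1 \<beta>1 \<beta>2) (y_m2 rt \<alpha>1 \<beta>2) * msc_cubic (A2 \<alpha>1 \<beta>1 \<beta>2) (y_p2 rt \<alpha>1 \<beta>2) = 0}
   \<union> {A3 (- ((\<beta>2 + 1)^2 / 12)) \<beta>2 | \<beta>2. True}
   \<union> {A4 \<alpha>1 \<beta>2 | \<alpha>1 \<beta>2. \<beta>2 \<noteq> 2*\<alpha>1 - 1}
   \<union> {A6 \<alpha>1 \<beta>1 | \<alpha>1 \<beta>1.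
        \<alpha>1 \<noteq> 1/3 \<and>
        msc_cubic (A6 \<alpha>1 \<beta>1) (y_m6 rt \<alpha>1) * msc_cubic (A6 \<alpha>1 \<beta>1) (y_p6 rt \<alpha>1) = 0}
   \<union> {A7 (- (1/12))}
   \<union> {A8 \<alpha>1 | \<alpha>1. \<alpha>1 \<noteq> 1/3}
   \<union> {A10}"

definition three_list :: "('a::field \<Rightarrow> 'a) \<Rightarrow> ('a^4^2) set" where
  "three_list rt =
     {A1 \<alpha>1 \<alpha>2 \<alpha>4 \<beta>1 | \<alpha>1 \<alpha>2 \<alpha>4 \<beta>1.
        \<alpha>4 \<noteq> 0 \<and>
        msc_cubic (A1 \<alpha>1 \<alpha>2 \<alpha>4 \<beta>1) (y_m1 rt \<alpha>1 \<alpha>2 \<alpha>4) *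
        msc_cubic (A1 \<alpha>1 \<alpha>2 \<alpha>4 \<beta>1) (y_p1 rt \<alpha>1 \<alpha>2 \<alpha>4) \<noteq> 0}
   \<union> {A1 \<alpha>1 \<alpha>2 0 \<beta>1 | \<alpha>1 \<alpha>2 \<beta>1.
        (3*\<alpha>2 + 1) * ((3*\<alpha>1 - 1)^2 + 4*(3*\<alpha>2 + 1)*\<beta>1) \<noteq> 0}
   \<union> {A2 \<alpha>1 \<beta>1 \<beta>2 | \<alpha>1 \<beta>1 \<beta>2.
        msc_cubic (A2 \<alpha>1 \<beta>1 \<beta>2) (y_m2 rt \<alpha>1 \<beta>2) * msc_cubic (A2 \<alpha>1 \<beta>1 \<beta>2) (y_p2 rt \<alpha>1 \<beta>2) \<noteq> 0}
   \<union> {A3 \<beta>1 \<beta>2 | \<beta>1 \<beta>2. (\<beta>2 + 1)^2 + 12*\<beta>1 \<noteq> 0}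
   \<union> {A6 \<alpha>1 \<beta>1 | \<alpha>1 \<beta>1.
        msc_cubic (A6 \<alpha>1 \<beta>1) (y_m6 rt \<alpha>1) * msc_cubic (A6 \<alpha>1 \<beta>1) (y_p6 rt \<alpha>1) \<noteq> 0}
   \<union> {A7 \<beta>1 | \<beta>1. 12*\<beta>1 + 1 \<noteq> 0}
   \<union> {A11}"

definition infinite_list :: "('a::field^4^2) set" where
  "infinite_list =
     {A1 (1/3) (- (1/3)) 0 0}
   \<union> {A4 \<alpha>1 (2*\<alpha>1 - 1) | \<alpha>1. True}
   \<union> {A8 (1/3)}"

definition isomorphic_to_one_of ::
  "('a::field \<Rightarrow> 'v::ab_group_add \<Rightarrow> 'v) \<Rightarrow> ('v \<Rightarrow> 'v \<Rightarrow> 'v) \<Rightarrow> ('a^4^2) set \<Rightarrow> bool" where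
  "isomorphic_to_one_of smul mul L \<longleftrightarrow>
     (\<exists>A\<in>L. algebra_isomorphic smul mul (*s) (msc_mul A))"

end

theory Submission
  imports Defs
begin

text \<open>The one-dimensional subalgebras are the lines on which the binary cubic form
  \<open>v \<mapsto> det (v, v v)\<close> vanishes, so counting them amounts to counting the projective zeros of
  \<open>msc_cubic\<close>. For a cubic \<open>f\<close> the number of zeros is read off the product of the values of \<open>f\<close> at
  the two zeros of its derivative, which is the discriminant up to a nonzero factor. It then remains
  to bring every nonzero product into one of the forms \<open>A1\<close>, ..., \<open>A12\<close>. This is done by means of
  the linear forms \<open>tr L\<close> and \<open>tr R\<close> (traces of left and right multiplication): if they are
  independent, the dual basis gives \<open>A1\<close>; if they are dependent and \<open>tr R \<noteq> 0\<close>, a basis adapted to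
  \<open>tr R\<close> leads to \<open>A2\<close>--\<open>A5\<close>; if \<open>tr R = 0 \<noteq> tr L\<close>, one obtains \<open>A6\<close>--\<open>A9\<close>; and if both vanish,
  the product is determined by the cubic form, which gives \<open>A10\<close>--\<open>A12\<close>.\<close>


section \<open>Structure constants with respect to a basis\<close>

lemma msc_nth [simp]:
  "msc a1 a2 a3 a4 b1 b2 b3 b4 $ 1 $ 1 = a1" "msc a1 a2 a3 a4 b1 b2 b3 b4 $ 1 $ 2 = a2"
  "msc a1 a2 a3 a4 b1 b2 b3 b4 $ 1 $ 3 = a3" "msc a1 a2 a3 a4 b1 b2 b3 b4 $ 1 $ 4 = a4"
  "msc a1 a2 a3 a4 b1 b2 b3 b4 $ 2 $ 1 = b1" "msc a1 a2 a3 a4 b1 b2 b3 b4 $ 2 $ 2 = b2"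
  "msc a1 a2 a3 a4 b1 b2 b3 b4 $ 2 $ 3 = b3" "msc a1 a2 a3 a4 b1 b2 b3 b4 $ 2 $ 4 = b4"
  by (simp_all add: msc_def vector_4)

lemma msc_eta:
  "msc (A$1$1) (A$1$2) (A$1$3) (A$1$4) (A$2$1) (A$2$2) (A$2$3) (A$2$4) = A"
  by (simp add: vec_eq_iff forall_2 forall_4)

lemma msc_mul_nth:
  "msc_mul A x y $ 1 = A$1$1 * (x$1 * y$1) + A$1$2 * (x$1 * y$2) + A$1$3 * (x$2 * y$1) + A$1$4 * (x$2 * y$2)"
  "msc_mul A x y $ 2 = A$2$1 * (x$1 * y$1) + A$2$2 * (x$1 * y$2) + A$2$3 * (x$2 * y$1) + A$2$4 * (x$2 * y$2)"
  by (simp_all add: msc_mul_def matrix_vector_mult_def sum_4 vector_4)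

text \<open>Cramer's rule for \<open>(X, Y) = x * (p, q) + y * (r, s)\<close>. It converts
  coordinates in an old basis into coordinates in the basis with rows \<open>(p, q)\<close> and
  \<open>(r, s)\<close>.\<close>

lemma cramer_two:
  fixes X Y p q r s :: "'a::field"
  defines "D \<equiv> p * s - q * r"
  assumes "D \<noteq> 0"
  shows "(X * s - Y * r) / D * p + (Y * p - X * q) / D * r = X"
    and "(X * s - Y * r) / D * q + (Y * p - X * q) / D * s = Y"
proof -
  have "(X * s - Y * r) / D * p + (Y * p - X * q) / D * r = ((X * s - Y * r) * p + (Y * p - X * q) * r) / D"
    by (simp add: add_divide_distrib)
  also have "(X * s - Y * r) * p + (Y * p - X * q) * r = X * D" unfolding D_def by algebra
  finally show "(X * s - Y * r) / D * p + (Y * p - X * q) / D * r = X" using assms(2) by simp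
  have "(X * s - Y * r) / D * q + (Y * p - X * q) / D * s = ((X * s - Y * r) * q + (Y * p - X * q) * s) / D"
    by (simp add: add_divide_distrib)
  also have "(X * s - Y * r) * q + (Y * p - X * q) * s = Y * D" unfolding D_def by algebra
  finally show "(X * s - Y * r) / D * q + (Y * p - X * q) / D * s = Y" using assms(2) by simp
qed

context nonassoc_algebra
begin

lemma mul_add_left: "mul (x + y) z = mul x z + mul y z"
  and mul_add_right: "mul z (x + y) = mul z x + mul z y"
  and mul_scale_left: "mul (smul c x) z = smul c (mul x z)"
  and mul_scale_right: "mul z (smul c x) = smul c (mul z x)"
  using linear_mul_left[of z] linear_mul_right[of z]
  by (simp_all add: Vector_Spaces.linear_def module_hom_def module_hom_axioms_def)

text \<open>An ordered basis, phrased as existence and uniqueness of coordinates, so that equations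
  between vectors turn directly into equations between scalars.\<close>

definition coord_basis :: "'v \<Rightarrow> 'v \<Rightarrow> bool" where
  "coord_basis e1 e2 \<longleftrightarrow>
     (\<forall>v. \<exists>x y. v = smul x e1 + smul y e2) \<and>
     (\<forall>x y. smul x e1 + smul y e2 = 0 \<longrightarrow> x = 0 \<and> y = 0)"

definition has_msc :: "'v \<Rightarrow> 'v \<Rightarrow> 'a^4^2 \<Rightarrow> bool" where
  "has_msc e1 e2 A \<longleftrightarrow> coord_basis e1 e2 \<and>
     mul e1 e1 = smul (A$1$1) e1 + smul (A$2$1) e2 \<and>
     mul e1 e2 = smul (A$1$2) e1 + smul (A$2$2) e2 \<and>
     mul e2 e1 = smul (A$1$3) e1 + smul (A$2$3) e2 \<and>
     mul e2 e2 = smul (A$1$4) e1 + smul (A$2$4) e2"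

lemma coord_basis_eq_iff:
  assumes "coord_basis e1 e2"
  shows "smul x e1 + smul y e2 = smul x' e1 + smul y' e2 \<longleftrightarrow> x = x' \<and> y = y'"
proof
  assume "smul x e1 + smul y e2 = smul x' e1 + smul y' e2"
  hence "smul (x - x') e1 + smul (y - y') e2 = 0"
    by (simp add: scale_left_diff_distrib algebra_simps)
  hence "x - x' = 0 \<and> y - y' = 0"
    using assms unfolding coord_basis_def by blast
  thus "x = x' \<and> y = y'" by simp
qed auto

lemma lincomb_lincomb:
  "smul x (smul p e1 + smul q e2) + smul y (smul r e1 + smul s e2) =
     smul (x * p + y * r) e1 + smul (x * q + y * s) e2"
  by (simp add: scale_right_distrib scale_left_distrib algebra_simps)

lemma mul_lincomb:
  assumes "has_msc e1 e2 A"
  shows "mul (smul x1 e1 + smul x2 e2) (smul y1 e1 + smul y2 e2) =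
    smul (A$1$1 * (x1 * y1) + A$1$2 * (x1 * y2) + A$1$3 * (x2 * y1) + A$1$4 * (x2 * y2)) e1 +
    smul (A$2$1 * (x1 * y1) + A$2$2 * (x1 * y2) + A$2$3 * (x2 * y1) + A$2$4 * (x2 * y2)) e2"
  using assms
  by (simp add: has_msc_def mul_add_left mul_add_right mul_scale_left mul_scale_right
      scale_right_distrib scale_left_distrib algebra_simps)

lemma coord_basis_change:
  assumes "coord_basis e1 e2" "p * s - q * r \<noteq> 0"
  shows "coord_basis (smul p e1 + smul q e2) (smul r e1 + smul s e2)"
  unfolding coord_basis_def
proof (intro conjI allI impI)
  fix v
  obtain x y where v: "v = smul x e1 + smul y e2"
    using assms(1) unfolding coord_basis_def by blast
  show "\<exists>x y. v = smul x (smul p e1 + smul q e2) + smul y (smul r e1 + smul s e2)"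
    unfolding v lincomb_lincomb using cramer_two[OF assms(2)] by metis
next
  fix x y
  assume "smul x (smul p e1 + smul q e2) + smul y (smul r e1 + smul s e2) = 0"
  hence "x * p + y * r = 0" "x * q + y * s = 0"
    using assms(1) unfolding lincomb_lincomb coord_basis_def by blast+
  hence "x * (p * s - q * r) = 0" "y * (p * s - q * r) = 0" by algebra+
  thus "x = 0" "y = 0" using assms(2) by auto
qed

text \<open>Each pair of equations compares, in the old basis, the two coordinates of one product of
  new basis vectors. Keeping the new constants implicit avoids inverting the transition
  matrix.\<close>

lemma has_msc_change_basis:
  assumes "has_msc e1 e2 (msc a1 a2 a3 a4 b1 b2 b3 b4)" "p * s - q * r \<noteq> 0"
    and "a1 * (p * p) + a2 * (p * q) + a3 * (q * p) + a4 * (q * q) = a1' * p + b1' * r"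
    and "b1 * (p * p) + b2 * (p * q) + b3 * (q * p) + b4 * (q * q) = a1' * q + b1' * s"
    and "a1 * (p * r) + a2 * (p * s) + a3 * (q * r) + a4 * (q * s) = a2' * p + b2' * r"
    and "b1 * (p * r) + b2 * (p * s) + b3 * (q * r) + b4 * (q * s) = a2' * q + b2' * s"
    and "a1 * (r * p) + a2 * (r * q) + a3 * (s * p) + a4 * (s * q) = a3' * p + b3' * r"
    and "b1 * (r * p) + b2 * (r * q) + b3 * (s * p) + b4 * (s * q) = a3' * q + b3' * s"
    and "a1 * (r * r) + a2 * (r * s) + a3 * (s * r) + a4 * (s * s) = a4' * p + b4' * r"
    and "b1 * (r * r) + b2 * (r * s) + b3 * (s * r) + b4 * (s * s) = a4' * q + b4' * s"
  shows "has_msc (smul p e1 + smul q e2) (smul r e1 + smul s e2)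
           (msc a1' a2' a3' a4' b1' b2' b3' b4')"
  unfolding has_msc_def msc_nth lincomb_lincomb mul_lincomb[OF assms(1)] assms(3-)
  using coord_basis_change[OF _ assms(2)] assms(1) by (simp add: has_msc_def)

text \<open>By bilinearity every product on the line is a multiple of
  \<open>mul v v\<close>.\<close>

lemma subalgebra_span_singleton: "subalgebra (span {v}) \<longleftrightarrow> mul v v \<in> span {v}"
proof
  assume "subalgebra (span {v})"
  thus "mul v v \<in> span {v}" by (simp add: subalgebra_def span_base)
next
  assume "mul v v \<in> span {v}"
  then obtain k where "mul v v = smul k v" unfolding span_singleton by blast
  hence "mul (smul a v) (smul b v) = smul (a * (b * k)) v" for a b
    by (simp add: mul_scale_left mul_scale_right)
  hence "\<forall>x\<in>span {v}. \<forall>y\<in>span {v}. mul x y \<in> span {v}"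
    unfolding span_singleton by blast
  thus "subalgebra (span {v})" by (simp add: subalgebra_def)
qed

lemma linear_to_plane_iff:
  "Vector_Spaces.linear smul (*s) f \<longleftrightarrow>
     (\<forall>x y. f (x + y) = f x + f y) \<and> (\<forall>c x. f (smul c x) = c *s f x)"
  using vector_space_axioms vec.vector_space_axioms
  by (auto simp: Vector_Spaces.linear_def module_hom_def module_hom_axioms_def module_iff_vector_space)

text \<open>The basis consists of the preimages of the standard basis vectors; conversely, the
  isomorphism is the inverse of the coordinate parametrisation \<open>g\<close>.\<close>

lemma algebra_isomorphic_iff_has_msc:
  "algebra_isomorphic smul mul (*s) (msc_mul A) \<longleftrightarrow> (\<exists>e1 e2. has_msc e1 e2 A)"
proof
  assume "algebra_isomorphic smul mul (*s) (msc_mul A)"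
  then obtain f where f: "Vector_Spaces.linear smul (*s) f" "bij f"
    and mult: "\<And>x y. f (mul x y) = msc_mul A (f x) (f y)"
    unfolding algebra_isomorphic_def by blast
  have add: "f (x + y) = f x + f y" and scl: "f (smul c x) = c *s f x" for x y c
    using f(1) unfolding linear_to_plane_iff by auto
  have inj: "f x = f y \<longleftrightarrow> x = y" for x y using f(2) by (metis bij_is_inj injD)
  obtain e1 e2 where e: "f e1 = vector [1, 0]" "f e2 = vector [0, 1]"
    using f(2) by (metis bij_pointE)
  have f0: "f 0 = 0" using scl[of 0 0] by simp
  have "coord_basis e1 e2"
    unfolding coord_basis_def
  proof (intro conjI allI impI)
    fix v
    have "f v = f (smul (f v $ 1) e1 + smul (f v $ 2) e2)"
      by (simp add: add scl e vec_eq_iff forall_2)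
    thus "\<exists>x y. v = smul x e1 + smul y e2" unfolding inj by blast
  next
    fix x y assume "smul x e1 + smul y e2 = 0"
    hence "f (smul x e1 + smul y e2) = 0" using f0 by simp
    thus "x = 0" "y = 0" by (auto simp add: add scl e vec_eq_iff forall_2)
  qed
  moreover have "mul e1 e1 = smul (A$1$1) e1 + smul (A$2$1) e2"
     "mul e1 e2 = smul (A$1$2) e1 + smul (A$2$2) e2"
     "mul e2 e1 = smul (A$1$3) e1 + smul (A$2$3) e2"
     "mul e2 e2 = smul (A$1$4) e1 + smul (A$2$4) e2"
    by (subst inj [symmetric], simp add: mult add scl e vec_eq_iff forall_2 msc_mul_nth)+
  ultimately show "\<exists>e1 e2. has_msc e1 e2 A" unfolding has_msc_def by blast
next
  assume "\<exists>e1 e2. has_msc e1 e2 A"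
  then obtain e1 e2 where e: "has_msc e1 e2 A" by blast
  hence b: "coord_basis e1 e2" by (simp add: has_msc_def)
  define g where "g x = smul (x$1) e1 + smul (x$2) e2" for x :: "'a^2"
  have inj: "g x = g y \<longleftrightarrow> x = y" for x y
    by (simp add: g_def coord_basis_eq_iff[OF b] vec_eq_iff forall_2)
  have "\<exists>x. g x = v" for v
  proof -
    obtain x y where "v = smul x e1 + smul y e2" using b unfolding coord_basis_def by blast
    hence "g (vector [x, y]) = v" by (simp add: g_def)
    thus ?thesis by blast
  qed
  hence bij: "bij g" using inj unfolding bij_def surj_def inj_def by metis
  hence g_inv: "g (inv g v) = v" for v by (simp add: bij_is_surj surj_f_inv_f)
  have "inv g (x + y) = inv g x + inv g y" for x y
  proof -
    have "g (inv g x + inv g y) = g (inv g x) + g (inv g y)"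
      unfolding g_def by (simp add: scale_left_distrib algebra_simps)
    thus ?thesis using inj g_inv by metis
  qed
  moreover have "inv g (smul c x) = c *s inv g x" for c x
  proof -
    have "g (c *s inv g x) = smul c (g (inv g x))"
      unfolding g_def by (simp add: scale_right_distrib)
    thus ?thesis using inj g_inv by metis
  qed
  moreover have "inv g (mul x y) = msc_mul A (inv g x) (inv g y)" for x y
  proof -
    have "g (msc_mul A (inv g x) (inv g y)) = mul (g (inv g x)) (g (inv g y))"
      unfolding g_def mul_lincomb[OF e] msc_mul_nth ..
    thus ?thesis using inj g_inv by metis
  qed
  ultimately show "algebra_isomorphic smul mul (*s) (msc_mul A)"
    unfolding algebra_isomorphic_def linear_to_plane_iff using bij_imp_bij_inv[OF bij] by blast
qed

end

text \<open>\<open>Some y\<close> stands for the line spanned by \<open>e1 + y e2\<close> and \<open>None\<close> for the one spanned by \<open>e2\<close>.\<close>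

definition proj_roots :: "'a::field^4^2 \<Rightarrow> 'a option set" where
  "proj_roots A = Some ` {y. msc_cubic A y = 0} \<union> (if A$1$4 = 0 then {None} else {})"

section \<open>One-dimensional subalgebras as projective zeros of the cubic\<close>

context two_dim_algebra
begin

lemma has_msc_exists: "\<exists>e1 e2 A. has_msc e1 e2 A"
proof -
  obtain B where B: "B \<subseteq> UNIV" "independent B" "UNIV \<subseteq> span B" "card B = 2"
    using basis_exists[of UNIV] dim_UNIV by metis
  then obtain e1 e2 where e: "B = {e1, e2}" "e1 \<noteq> e2" by (metis card_2_iff)
  have sp: "\<exists>x y. v = smul x e1 + smul y e2" for v
  proof -
    have "v \<in> span {e1, e2}" using B(3) e by auto
    then obtain k where "v - smul k e1 \<in> span {e2}" unfolding span_breakdown_eq[of v e1] by blast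
    then obtain l where "v - smul k e1 = smul l e2" unfolding span_singleton by blast
    hence "v = smul k e1 + smul l e2" by (simp add: algebra_simps)
    thus ?thesis by blast
  qed
  have cb: "coord_basis e1 e2"
    unfolding coord_basis_def
  proof (intro conjI allI sp impI)
    fix x y assume 0: "smul x e1 + smul y e2 = 0"
    have ind: "e1 \<notin> span {e2}" "e2 \<noteq> 0"
      using B(2) e by (simp_all add: independent_insert)
    show "x = 0"
    proof (rule ccontr)
      assume "x \<noteq> 0"
      have "smul x e1 = smul (- y) e2"
        using 0 by (simp add: eq_neg_iff_add_eq_0)
      hence "smul (1 / x) (smul x e1) = smul (1 / x) (smul (- y) e2)" by simp
      hence "e1 = smul (1 / x * - y) e2" using \<open>x \<noteq> 0\<close> by simp
      thus False using ind(1) unfolding span_singleton by blast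
    qed
    thus "y = 0" using 0 ind(2) by simp
  qed
  obtain a1 b1 where 1: "mul e1 e1 = smul a1 e1 + smul b1 e2" using sp by blast
  obtain a2 b2 where 2: "mul e1 e2 = smul a2 e1 + smul b2 e2" using sp by blast
  obtain a3 b3 where 3: "mul e2 e1 = smul a3 e1 + smul b3 e2" using sp by blast
  obtain a4 b4 where 4: "mul e2 e2 = smul a4 e1 + smul b4 e2" using sp by blast
  have "has_msc e1 e2 (msc a1 a2 a3 a4 b1 b2 b3 b4)"
    by (simp add: has_msc_def cb 1 2 3 4)
  thus ?thesis by blast
qed

lemma nontrivial_subalgebras_eq:
  "nontrivial_subalgebras = {span {v} | v. v \<noteq> 0 \<and> mul v v \<in> span {v}}"
proof (intro equalityI subsetI)
  fix W assume "W \<in> nontrivial_subalgebras"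
  hence W: "subalgebra W" "dim W = 1" unfolding nontrivial_subalgebras_def by auto
  obtain B where B: "B \<subseteq> W" "independent B" "W \<subseteq> span B" "card B = 1"
    using basis_exists[of W] W(2) by metis
  then obtain v where v: "B = {v}" by (metis card_1_singletonE)
  have "W = span {v}"
    using B v W(1) by (metis span_minimal subalgebra_def subset_antisym)
  moreover have "v \<noteq> 0" using B(2) v dependent_zero by blast
  ultimately show "W \<in> {span {v} | v. v \<noteq> 0 \<and> mul v v \<in> span {v}}"
    using W(1) subalgebra_span_singleton by blast
next
  fix W assume "W \<in> {span {v} | v. v \<noteq> 0 \<and> mul v v \<in> span {v}}"
  then obtain v where v: "W = span {v}" "v \<noteq> 0" "mul v v \<in> span {v}" by blast
  have "dim (span {v}) = card {v}"
    using v(2) by (intro dim_span_eq_card_independent) simp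
  thus "W \<in> nontrivial_subalgebras"
    using v by (simp add: nontrivial_subalgebras_def subalgebra_span_singleton)
qed

text \<open>The map sending \<open>z\<close> to \<open>span {pt z}\<close> is a bijection from the
  affine line with a point at infinity onto the lines of the plane, and it restricts to projective
  zeros and subalgebras. Finiteness is recorded separately because \<open>card\<close> is 0 on every
  infinite set.\<close>

lemma card_nontrivial_subalgebras:
  assumes "has_msc e1 e2 A"
  shows "card nontrivial_subalgebras = card (proj_roots A)"
    and "finite nontrivial_subalgebras \<longleftrightarrow> finite (proj_roots A)"
proof -
  have b: "coord_basis e1 e2" using assms by (simp add: has_msc_def)
  note eq_iff = coord_basis_eq_iff[OF b]
  define pt where "pt z = (case z of None \<Rightarrow> e2 | Some y \<Rightarrow> e1 + smul y e2)" for z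
  have scl: "smul c (pt None) = smul 0 e1 + smul c e2"
    "smul c (pt (Some y)) = smul c e1 + smul (c * y) e2" for c y
    by (simp_all add: pt_def scale_right_distrib)
  have pt_ne: "pt z \<noteq> 0" for z
  proof
    assume "pt z = 0"
    hence "smul 1 (pt z) = smul 0 e1 + smul 0 e2" by simp
    thus False by (cases z; simp only: scl eq_iff) auto
  qed
  have line: "\<exists>z. span {v} = span {pt z}" if "v \<noteq> 0" for v
  proof -
    obtain x y where v: "v = smul x e1 + smul y e2" using b unfolding coord_basis_def by blast
    have "\<exists>z c. c \<noteq> 0 \<and> v = smul c (pt z)"
    proof (cases "x = 0")
      case True
      hence "y \<noteq> 0" "v = smul y (pt None)" using that v by (auto simp: scl)
      thus ?thesis by blast
    next
      case False
      hence "v = smul x (pt (Some (y / x)))" by (simp add: v scl)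
      thus ?thesis using False by blast
    qed
    then obtain z c where zc: "c \<noteq> 0" "v = smul c (pt z)" by blast
    have "span {v} = span {pt z}" 
    proof (intro equalityI span_minimal)
      show "{v} \<subseteq> span {pt z}" using zc by (auto simp: span_singleton)
      have "pt z = smul (1 / c) v" using zc by simp
      thus "{pt z} \<subseteq> span {v}" unfolding span_singleton by blast
    qed simp_all
    thus ?thesis by blast
  qed
  have inj: "z = z'" if "span {pt z} = span {pt z'}" for z z'
  proof -
    have "pt z \<in> span {pt z'}" using that span_base by blast
    then obtain c where "smul 1 (pt z) = smul c (pt z')" by (auto simp: span_singleton)
    thus ?thesis by (cases z; cases z'; simp only: scl eq_iff) auto
  qed
  have root: "mul (pt z) (pt z) \<in> span {pt z} \<longleftrightarrow> z \<in> proj_roots A" for z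
  proof (cases z)
    case None
    have "mul (pt z) (pt z) = smul (A$1$4) e1 + smul (A$2$4) e2"
      using assms by (simp add: None pt_def has_msc_def)
    hence "mul (pt z) (pt z) \<in> span {pt z} \<longleftrightarrow>
        (\<exists>c. smul (A$1$4) e1 + smul (A$2$4) e2 = smul c (pt None))"
      by (simp add: span_singleton image_iff None)
    thus ?thesis unfolding scl eq_iff by (auto simp: None proj_roots_def)
  next
    case (Some y)
    have "mul (pt z) (pt z) = mul (smul 1 e1 + smul y e2) (smul 1 e1 + smul y e2)"
      by (simp add: Some pt_def)
    hence "mul (pt z) (pt z) \<in> span {pt z} \<longleftrightarrow>
        (\<exists>c. mul (smul 1 e1 + smul y e2) (smul 1 e1 + smul y e2) = smul c (pt (Some y)))"
      by (simp add: span_singleton image_iff Some)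
    \<comment> \<open>The first coordinate determines the factor \<open>c\<close>; the second then
      says that the determinant of \<open>v\<close> and \<open>v v\<close> vanishes.\<close>
    also have "\<dots> \<longleftrightarrow> (A$2$1 + A$2$2 * y + A$2$3 * y + A$2$4 * (y * y) =
        (A$1$1 + A$1$2 * y + A$1$3 * y + A$1$4 * (y * y)) * y)"
      unfolding mul_lincomb[OF assms] scl eq_iff by auto
    also have "\<dots> \<longleftrightarrow> msc_cubic A y = 0"
      unfolding msc_cubic_def by algebra
    finally show ?thesis by (auto simp: Some proj_roots_def)
  qed
  have "(\<lambda>z. span {pt z}) ` proj_roots A = nontrivial_subalgebras"
    unfolding nontrivial_subalgebras_eq
  proof (intro equalityI subsetI)
    fix W assume "W \<in> (\<lambda>z. span {pt z}) ` proj_roots A"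
    thus "W \<in> {span {v} | v. v \<noteq> 0 \<and> mul v v \<in> span {v}}" using root pt_ne by blast
  next
    fix W assume "W \<in> {span {v} | v. v \<noteq> 0 \<and> mul v v \<in> span {v}}"
    then obtain v z where v: "v \<noteq> 0" "mul v v \<in> span {v}" and W: "W = span {v}" "W = span {pt z}"
      using line by blast
    have "subalgebra (span {pt z})" using v W subalgebra_span_singleton by metis
    thus "W \<in> (\<lambda>z. span {pt z}) ` proj_roots A"
      using W root subalgebra_span_singleton by blast
  qed
  hence "bij_betw (\<lambda>z. span {pt z}) (proj_roots A) nontrivial_subalgebras"
    using inj by (intro bij_betw_imageI inj_onI)
  thus "card nontrivial_subalgebras = card (proj_roots A)"
    "finite nontrivial_subalgebras \<longleftrightarrow> finite (proj_roots A)"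
    by (simp_all add: bij_betw_same_card bij_betw_finite)
qed

end


section \<open>Zeros of polynomials of degree at most three\<close>

text \<open>The field hypotheses in the form used below: \<open>rt\<close> solves quadratics after
  completing the square, and \<open>cubic\<close> supplies one zero of each cubic.\<close>

locale root_closed_field =
  fixes rt :: "'a::field \<Rightarrow> 'a"
  assumes rt: "rt z ^ 2 = z"
    and two: "(2::'a) \<noteq> 0" and three: "(3::'a) \<noteq> 0"
    and cubic: "a \<noteq> 0 \<Longrightarrow> \<exists>y::'a. a * y^3 + b * y^2 + c * y + d = 0"
begin

lemma sqrt: "\<exists>w::'a. w^2 = z"
  using rt by blast

lemma card_roots_quadratic:
  fixes a b c :: 'a
  assumes a: "a \<noteq> 0"
  shows "card {y. a * y^2 + b * y + c = 0} = (if b^2 - 4 * a * c = 0 then 1 else 2)"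
proof -
  obtain w where w: "w^2 = b^2 - 4 * a * c" using sqrt by blast
  have "a * y^2 + b * y + c = 0 \<longleftrightarrow> y = (- b + w) / (2 * a) \<or> y = (- b - w) / (2 * a)" for y
  proof -
    \<comment> \<open>Completing the square. The factor 4 is written \<open>2 * 2\<close> so that it
      is visibly a product of nonzero elements.\<close>
    have "(2 * 2 * a) * (a * y^2 + b * y + c) = (y * (2 * a) - (- b + w)) * (y * (2 * a) - (- b - w))"
      using w by algebra
    moreover have "2 * 2 * a \<noteq> 0" "2 * a \<noteq> 0" using two a by (simp_all only: mult_eq_0_iff simp_thms)
    ultimately have "a * y^2 + b * y + c = 0 \<longleftrightarrow>
        y * (2 * a) - (- b + w) = 0 \<or> y * (2 * a) - (- b - w) = 0"
      by (metis mult_eq_0_iff)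
    thus ?thesis using \<open>2 * a \<noteq> 0\<close> by (simp add: nonzero_eq_divide_eq)
  qed
  hence "{y. a * y^2 + b * y + c = 0} = {(- b + w) / (2 * a), (- b - w) / (2 * a)}" by blast
  moreover have "(- b + w) / (2 * a) = (- b - w) / (2 * a) \<longleftrightarrow> w = 0"
  proof -
    have "(- b + w) / (2 * a) = (- b - w) / (2 * a) \<longleftrightarrow> - b + w = - b - w"
      using two a by simp
    also have "\<dots> \<longleftrightarrow> 2 * w = 0" by (simp add: algebra_simps eq_neg_iff_add_eq_0 mult_2)
    finally show ?thesis using two by simp
  qed
  moreover have "w = 0 \<longleftrightarrow> b^2 - 4 * a * c = 0" using w by (metis zero_eq_power2)
  ultimately show ?thesis by auto
qed

section \<open>Cubics, their discriminant and their multiple zeros\<close>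

lemma cubic_splits:
  fixes a b c d :: 'a
  assumes a: "a \<noteq> 0"
  obtains r s t where "\<And>y. a * y^3 + b * y^2 + c * y + d = a * ((y - r) * (y - s) * (y - t))"
    "b = - a * (r + s + t)" "c = a * (r * s + s * t + r * t)"
proof -
  obtain r where r: "a * r^3 + b * r^2 + c * r + d = 0" using cubic a by blast
  \<comment> \<open>\<open>a\<close>, \<open>m\<close> and \<open>n\<close> are the coefficients of
    the quotient of the cubic by \<open>y - r\<close>; its zeros \<open>s\<close> and
    \<open>t\<close> come from the quadratic formula.\<close>
  define m n where "m = a * r + b" and "n = a * r^2 + b * r + c"
  obtain w where w: "w^2 = m^2 - 4 * a * n" using sqrt by blast
  define s t where "s = (- m + w) / (2 * a)" and "t = (- m - w) / (2 * a)"
  have st: "2 * a * s = - m + w" "2 * a * t = - m - w" unfolding s_def t_def using two a by simp_all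
  have "2 * a * (s + t) = 2 * - m" using st by algebra
  hence "2 * (a * (s + t)) = 2 * - m" by (simp only: mult.assoc)
  hence sum: "a * (s + t) = - m" using two mult_left_cancel by blast
  have "(2 * 2 * a) * (a * (s * t)) = (2 * 2 * a) * n" using st w by algebra
  moreover have "2 * 2 * a \<noteq> 0" using two a by (simp only: mult_eq_0_iff simp_thms)
  ultimately have prod: "a * (s * t) = n" using mult_left_cancel by blast
  show ?thesis
  proof (rule that)
    show b: "b = - a * (r + s + t)" using sum unfolding m_def by algebra
    show c: "c = a * (r * s + s * t + r * t)" using sum prod unfolding m_def n_def by algebra
    show "a * y^3 + b * y^2 + c * y + d = a * ((y - r) * (y - s) * (y - t))" for y
      using r unfolding b c by algebra
  qed
qed

text \<open>If \<open>u\<close> and \<open>v\<close> are the zeros of the derivative and \<open>r, s, t\<close> those of the cubic \<open>f\<close>, then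
  \<open>3 (u - r) (v - r) = (r - s) (r - t)\<close>, so \<open>f u * f v\<close> is the discriminant up to a unit.\<close>

lemma card_roots_cubic:
  fixes a b c d u v :: 'a
  assumes a: "a \<noteq> 0"
    and sum: "3 * a * (u + v) = - 2 * b" and prod: "3 * a * (u * v) = c"
  defines "f \<equiv> \<lambda>y. a * y^3 + b * y^2 + c * y + d"
  shows "card {y. f y = 0} = (if f u * f v \<noteq> 0 then 3 else if b^2 = 3 * a * c then 1 else 2)"
proof -
  obtain r s t where f: "\<And>y. a * y^3 + b * y^2 + c * y + d = a * ((y - r) * (y - s) * (y - t))"
    and b: "b = - a * (r + s + t)" and c: "c = a * (r * s + s * t + r * t)"
    using cubic_splits[OF a] by metis
  have f: "f y = a * ((y - r) * (y - s) * (y - t))" for y unfolding f_def f ..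
  have roots: "{y. f y = 0} = {r, s, t}" using a unfolding f by auto
  have sum': "3 * (u + v) = 2 * (r + s + t)"
  proof -
    have "a * (3 * (u + v)) = a * (2 * (r + s + t))" using sum unfolding b by algebra
    thus ?thesis using a mult_left_cancel by blast
  qed
  have prod': "3 * (u * v) = r * s + s * t + r * t"
  proof -
    have "a * (3 * (u * v)) = a * (r * s + s * t + r * t)" using prod unfolding c by algebra
    thus ?thesis using a mult_left_cancel by blast
  qed
  \<comment> \<open>Both sides are the derivative of \<open>(y - r) * (y - s) * (y - t)\<close> at
    one of its zeros: once through the zeros \<open>u, v\<close> of the derivative, once by the
    product rule.\<close>
  have key: "3 * ((u - r) * (v - r)) = (r - s) * (r - t)" "3 * ((u - s) * (v - s)) = (s - r) * (s - t)"
    "3 * ((u - t) * (v - t)) = (t - r) * (t - s)"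
    using sum' prod' by algebra+
  have "(3 * 3 * 3) * (f u * f v) = a^2 * ((3 * ((u - r) * (v - r))) * (3 * ((u - s) * (v - s))) * (3 * ((u - t) * (v - t))))"
    unfolding f by algebra
  hence "(3 * 3 * 3) * (f u * f v) = a^2 * (((r - s) * (r - t)) * ((s - r) * (s - t)) * ((t - r) * (t - s)))"
    unfolding key .
  hence disc: "f u * f v = 0 \<longleftrightarrow> r = s \<or> r = t \<or> s = t"
    using a three by (metis (no_types, opaque_lifting) mult_eq_0_iff power_eq_0_iff right_minus_eq)
  \<comment> \<open>Up to \<open>a^2\<close> this is a symmetric expression in the zeros. As soon as
    two of them coincide it becomes the square of the remaining difference, so it tells a triple
    zero from a double one.\<close>
  have hess: "b^2 = 3 * a * c \<longleftrightarrow> (r - s)^2 + (s - t) * (r - t) = 0"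
  proof -
    have "b^2 - 3 * a * c = a^2 * ((r - s)^2 + (s - t) * (r - t))" unfolding b c by algebra
    thus ?thesis using a by (metis eq_iff_diff_eq_0 mult_eq_0_iff power_eq_0_iff)
  qed
  show ?thesis
    unfolding disc hess roots by (auto simp: card_insert_if)
qed

text \<open>Matches the explicit formulas for the critical points. In the degenerate case both equal
  \<open>- b / (3 * a)\<close>, where the cubic has the value \<open>d - b^3 / (27 * a^2)\<close>;
  this turns the vanishing of the product into an explicit value of the constant term.\<close>

lemma card_roots_cubic_sqrt:
  fixes a b c d u v w :: 'a
  assumes a: "a \<noteq> 0"
    and w: "w^2 = b^2 - 3 * a * c" and u: "3 * a * u = - b - w" and v: "3 * a * v = - b + w"
  defines "f \<equiv> \<lambda>y. a * y^3 + b * y^2 + c * y + d"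
  shows "card {y. f y = 0} = (if f u * f v \<noteq> 0 then 3 else if b^2 = 3 * a * c then 1 else 2)"
    and "b^2 = 3 * a * c \<Longrightarrow> f u * f v = 0 \<longleftrightarrow> 27 * a^2 * d = b^3"
proof -
  have a3: "3 * a \<noteq> 0" using a three by simp
  have "3 * a * (u + v) = - 2 * b" using u v by algebra
  moreover have "3 * a * (3 * a * (u * v)) = 3 * a * c" using u v w by algebra
  hence "3 * a * (u * v) = c" using a3 mult_left_cancel by blast
  ultimately show "card {y. f y = 0} = (if f u * f v \<noteq> 0 then 3 else if b^2 = 3 * a * c then 1 else 2)"
    unfolding f_def by (rule card_roots_cubic[OF a])
next
  assume h: "b^2 = 3 * a * c"
  have "w = 0" using w h by simp
  have a3: "3 * a \<noteq> 0" using a three by simp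
  have "3 * a * u = 3 * a * v" using u v \<open>w = 0\<close> by simp
  hence uv: "3 * a * u = - b" "u = v"
    using u \<open>w = 0\<close> a3 mult_left_cancel by (simp, blast)
  have "3 * (3 * a) * (3 * a) * f u = 27 * a^2 * d - b^3"
    unfolding f_def using uv(1) h by algebra
  moreover have "3 * (3 * a) * (3 * a) \<noteq> 0" using a three by (simp only: mult_eq_0_iff simp_thms)
  ultimately have "f u = 0 \<longleftrightarrow> 27 * a^2 * d = b^3"
    by (metis eq_iff_diff_eq_0 mult_eq_0_iff)
  thus "f u * f v = 0 \<longleftrightarrow> 27 * a^2 * d = b^3" using uv(2) by simp
qed

text \<open>Squaring is surjective, so on a finite field it would be injective; but 1 and -1 have
  the same square and differ.\<close>

lemma infinite_field: "infinite (UNIV :: 'a set)"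
proof
  assume "finite (UNIV :: 'a set)"
  moreover have "surj (\<lambda>w::'a. w^2)" using sqrt by (metis surjI surj_def)
  ultimately have "inj (\<lambda>w::'a. w^2)" by (rule finite_UNIV_surj_inj)
  hence "(1::'a) = - 1" by (rule injD) simp
  thus False using two by (simp add: eq_neg_iff_add_eq_0)
qed

end


section \<open>Normal forms\<close>

text \<open>The normal forms without side conditions on the parameters; they are sorted by their
  number of zeros only afterwards.\<close>

definition families :: "('a::field^4^2) set" where
  "families =
     {A1 \<alpha>1 \<alpha>2 \<alpha>4 \<beta>1 | \<alpha>1 \<alpha>2 \<alpha>4 \<beta>1. True} \<union> {A2 \<alpha>1 \<beta>1 \<beta>2 | \<alpha>1 \<beta>1 \<beta>2. True} \<union>
     {A3 \<beta>1 \<beta>2 | \<beta>1 \<beta>2. True} \<union> {A4 \<alpha>1 \<beta>2 | \<alpha>1 \<beta>2. True} \<union> {A5 \<alpha>1 | \<alpha>1. True} \<union>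
     {A6 \<alpha>1 \<beta>1 | \<alpha>1 \<beta>1. True} \<union> {A7 \<beta>1 | \<beta>1. True} \<union> {A8 \<alpha>1 | \<alpha>1. True} \<union>
     {A9, A10, A11, A12}"

lemma mem_families:
  "A1 \<alpha>1 \<alpha>2 \<alpha>4 \<beta>1 \<in> families" "A2 \<alpha>1 \<beta>1 \<beta>2 \<in> families" "A3 \<beta>1 \<beta>2 \<in> families"
  "A4 \<alpha>1 \<beta>2 \<in> families" "A5 \<alpha>1 \<in> families" "A6 \<alpha>1 \<beta>1 \<in> families" "A7 \<beta>1 \<in> families"
  "A8 \<alpha>1 \<in> families" "A9 \<in> families" "A10 \<in> families" "A11 \<in> families" "A12 \<in> families"
  unfolding families_def by blast+

section \<open>Elementary changes of basis\<close>

context nonassoc_algebra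
begin

text \<open>Hiding the basis lets successive changes of basis be chained as plain
  implications.\<close>

definition admits :: "'a^4^2 \<Rightarrow> bool" where
  "admits A \<longleftrightarrow> (\<exists>e1 e2. has_msc e1 e2 A)"

text \<open>The new basis is \<open>e1 + t e2, e2\<close>; the instantiation lists
  \<open>p, s, q, r\<close> in their order of occurrence. The new constants are variables tied by
  equations, so that simplified expressions can be supplied for them.\<close>

lemma admits_shift:
  assumes A: "admits (msc a1 a2 a3 a4 b1 b2 b3 b4)"
    and c: "c1 = a1 + t * (a2 + a3) + t^2 * a4" "c2 = a2 + t * a4" "c3 = a3 + t * a4"
    and d: "d1 = b1 + t * (b2 + b3) + t^2 * b4 - t * c1" "d2 = b2 + t * b4 - t * c2"
      "d3 = b3 + t * b4 - t * c3" "d4 = b4 - t * a4"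
  shows "admits (msc c1 c2 c3 a4 d1 d2 d3 d4)"
proof -
  obtain e1 e2 where e: "has_msc e1 e2 (msc a1 a2 a3 a4 b1 b2 b3 b4)"
    using A unfolding admits_def by blast
  show ?thesis
    unfolding admits_def c d
    by (intro exI, rule has_msc_change_basis[OF e, of 1 1 t 0])
      (simp_all add: algebra_simps power2_eq_square)
qed

text \<open>The new basis is \<open>u e1, v e2\<close>.\<close>

lemma admits_scale:
  assumes "admits (msc a1 a2 a3 a4 b1 b2 b3 b4)" and "u \<noteq> 0" "v \<noteq> 0"
  shows "admits (msc (u * a1) (v * a2) (v * a3) (v^2 * a4 / u)
           (u^2 * b1 / v) (u * b2) (u * b3) (v * b4))"
proof -
  obtain e1 e2 where e: "has_msc e1 e2 (msc a1 a2 a3 a4 b1 b2 b3 b4)"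
    using assms(1) unfolding admits_def by blast
  show ?thesis
    unfolding admits_def
    by (intro exI, rule has_msc_change_basis[OF e, of u v 0 0])
      (use assms(2,3) in \<open>simp_all add: algebra_simps power2_eq_square\<close>)
qed

lemma admits_swap:
  assumes "admits (msc a1 a2 a3 a4 b1 b2 b3 b4)"
  shows "admits (msc b4 b3 b2 b1 a4 a3 a2 a1)"
proof -
  obtain e1 e2 where e: "has_msc e1 e2 (msc a1 a2 a3 a4 b1 b2 b3 b4)"
    using assms(1) unfolding admits_def by blast
  show ?thesis
    unfolding admits_def
    by (intro exI, rule has_msc_change_basis[OF e, of 0 0 1 1]) simp_all
qed

text \<open>In the basis \<open>e1, e2\<close> the linear form \<open>x \<mapsto> tr (y \<mapsto> x y)\<close> has the coordinates \<open>a1 + b2\<close> and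
  \<open>a3 + b4\<close>, and \<open>x \<mapsto> tr (y \<mapsto> y x)\<close> has the coordinates \<open>a1 + b3\<close> and \<open>a2 + b4\<close>.\<close>

lemma admits_change_traces:
  assumes "admits (msc a1 a2 a3 a4 b1 b2 b3 b4)" and d: "p * s - q * r \<noteq> 0"
  obtains c1 c2 c3 c4 d1 d2 d3 d4 where "admits (msc c1 c2 c3 c4 d1 d2 d3 d4)"
    "c1 + d2 = p * (a1 + b2) + q * (a3 + b4)" "c3 + d4 = r * (a1 + b2) + s * (a3 + b4)"
    "c1 + d3 = p * (a1 + b3) + q * (a2 + b4)" "c2 + d4 = r * (a1 + b3) + s * (a2 + b4)"
proof -
  obtain e1 e2 where e: "has_msc e1 e2 (msc a1 a2 a3 a4 b1 b2 b3 b4)"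
    using assms(1) unfolding admits_def by blast
  define D where "D = p * s - q * r"
  have D: "D \<noteq> 0" using d D_def by simp
  \<comment> \<open>\<open>Xi\<close> and \<open>Yi\<close> are the old coordinates of the products
    of the new basis vectors; Cramer's rule converts them into the new structure constants.\<close>
  define X1 where "X1 = a1 * (p * p) + a2 * (p * q) + a3 * (q * p) + a4 * (q * q)"
  define Y1 where "Y1 = b1 * (p * p) + b2 * (p * q) + b3 * (q * p) + b4 * (q * q)"
  define X2 where "X2 = a1 * (p * r) + a2 * (p * s) + a3 * (q * r) + a4 * (q * s)"
  define Y2 where "Y2 = b1 * (p * r) + b2 * (p * s) + b3 * (q * r) + b4 * (q * s)"
  define X3 where "X3 = a1 * (r * p) + a2 * (r * q) + a3 * (s * p) + a4 * (s * q)"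
  define Y3 where "Y3 = b1 * (r * p) + b2 * (r * q) + b3 * (s * p) + b4 * (s * q)"
  define X4 where "X4 = a1 * (r * r) + a2 * (r * s) + a3 * (s * r) + a4 * (s * s)"
  define Y4 where "Y4 = b1 * (r * r) + b2 * (r * s) + b3 * (s * r) + b4 * (s * s)"
  note cramer = cramer_two[OF d, folded D_def]
  \<comment> \<open>Each new trace coordinate is a sum of two Cramer quotients, so clearing the
    common determinant reduces the claim to a polynomial identity.\<close>
  have tr: "(X * s - Y * r) / D + (Y' * p - X' * q) / D = Z"
    if "X * s - Y * r + (Y' * p - X' * q) = Z * D" for X Y X' Y' Z
    using that D by (metis add_divide_distrib nonzero_mult_div_cancel_right)
  show ?thesis
  proof (rule that)
    show "admits (msc ((X1 * s - Y1 * r) / D) ((X2 * s - Y2 * r) / D) ((X3 * s - Y3 * r) / D) ((X4 * s - Y4 * r) / D)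
      ((Y1 * p - X1 * q) / D) ((Y2 * p - X2 * q) / D) ((Y3 * p - X3 * q) / D) ((Y4 * p - X4 * q) / D))"
      unfolding admits_def
      by (intro exI, rule has_msc_change_basis[OF e d])
         (simp_all only: cramer X1_def [symmetric] X2_def [symmetric] X3_def [symmetric] X4_def [symmetric]
          Y1_def [symmetric] Y2_def [symmetric] Y3_def [symmetric] Y4_def [symmetric])
  qed (rule tr, simp only: D_def X1_def X2_def X3_def X4_def Y1_def Y2_def Y3_def Y4_def, algebra)+
qed

end

section \<open>Reduction to normal form by the trace forms\<close>

locale root_closed_algebra = two_dim_algebra smul mul + root_closed_field rt
  for smul :: "'a::field \<Rightarrow> 'v::ab_group_add \<Rightarrow> 'v" and mul
    and rt :: "'a \<Rightarrow> 'a"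
begin

text \<open>The right trace has coordinates \<open>(1, 0)\<close> and the left trace vanishes on
  \<open>e2\<close>. If \<open>a4\<close> is nonzero, scaling makes it 1 and a shift clears
  \<open>a\<close>, giving \<open>A2\<close>. If \<open>a4 = 0\<close> and \<open>a\<close> is
  nonzero, scaling makes \<open>a\<close> equal to 1 and a shift clears \<open>a1\<close>, giving
  \<open>A3\<close>. Otherwise a shift clears \<open>b1\<close>, unless
  \<open>b2 = 2 * a1 - 1\<close>, when \<open>b1\<close> can only be rescaled; this gives
  \<open>A4\<close> and \<open>A5\<close>.\<close>

lemma admits_families_of_right_trace:
  assumes A: "admits (msc a1 a a a4 b1 b2 (1 - a1) (- a))"
  shows "\<exists>B\<in>families. admits B"
proof (cases "a4 = 0")
  case False
  obtain w where w: "w^2 = a4" using sqrt by blast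
  hence w0: "w \<noteq> 0" using False by auto
  define c where "c = a / w"
  have "admits (msc a1 c c 1 (b1 * w) b2 (1 - a1) (- c))"
    using admits_scale[OF A, of 1 "1 / w"] w0 False w by (simp add: power_divide c_def)
  hence "admits (msc (a1 - c^2) 0 0 1 (b1 * w - c * (b2 + (1 - a1)) - c^3 + c * (a1 - c^2))
      (b2 + c^2) (1 - (a1 - c^2)) 0)"
    by (rule admits_shift[where t = "- c"]) algebra+
  thus ?thesis using mem_families(2) unfolding A2_def by blast
next
  case a4: True
  show ?thesis
  proof (cases "a = 0")
    case False
    \<comment> \<open>With \<open>a2 = a3 = 1\<close> and \<open>a4 = 0\<close>, a shift by
      \<open>t\<close> adds \<open>2 * t\<close> to \<open>a1\<close>, so \<open>t = - h\<close>
      clears it.\<close>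
    define h where "h = a1 / 2"
    have h: "a1 = 2 * h" using two by (simp add: h_def)
    have "admits (msc a1 1 1 0 (b1 * a) b2 (1 - a1) (- 1))"
      using admits_scale[OF A, of 1 "1 / a"] a4 False by simp
    hence "admits (msc 0 1 1 0 (b1 * a - h * (b2 + (1 - a1)) - h^2)
        (b2 + 2 * h) 1 (- 1))"
      by (rule admits_shift[where t = "- h"], unfold h) algebra+
    thus ?thesis using mem_families(3) unfolding A3_def by blast
  next
    case a: True
    have A': "admits (msc a1 0 0 0 b1 b2 (1 - a1) 0)" using A a4 a by simp
    consider "b2 \<noteq> 2 * a1 - 1" | "b2 = 2 * a1 - 1" "b1 = 0" | "b2 = 2 * a1 - 1" "b1 \<noteq> 0" by blast
    thus ?thesis
    proof cases
      case 1
      \<comment> \<open>A shift by \<open>t\<close> subtracts \<open>t * (2 * a1 - 1 - b2)\<close>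
        from \<open>b1\<close>.\<close>
      define t where "t = b1 / (2 * a1 - 1 - b2)"
      have "t * (2 * a1 - 1 - b2) = b1" unfolding t_def using 1 by simp
      hence "admits (msc a1 0 0 0 0 b2 (1 - a1) 0)"
        by (intro admits_shift[OF A', where t = t]) (simp_all add: algebra_simps)
      thus ?thesis using mem_families(4) unfolding A4_def by blast
    next
      case 2
      thus ?thesis using A' mem_families(4) unfolding A4_def by blast
    next
      case 3
      have "admits (msc a1 0 0 0 1 b2 (1 - a1) 0)" using admits_scale[OF A', of 1 b1] 3 by simp
      thus ?thesis using mem_families(5)[of a1] 3 unfolding A5_def by blast
    qed
  qed
qed

text \<open>The same reduction when the right trace is zero and the left trace has coordinates
  \<open>(1, 0)\<close>. In the last case a shift changes \<open>b1\<close> by a multiple of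
  \<open>3 * a1 - 1\<close>, so for \<open>3 * a1 = 1\<close> a nonzero \<open>b1\<close> persists
  and leads to \<open>A9\<close>.\<close>

lemma admits_families_of_left_trace:
  assumes A: "admits (msc a1 a a a4 b1 (1 - a1) (- a1) (- a))"
  shows "\<exists>B\<in>families. admits B"
proof (cases "a4 = 0")
  case False
  obtain w where w: "w^2 = a4" using sqrt by blast
  hence w0: "w \<noteq> 0" using False by auto
  define c where "c = a / w"
  have "admits (msc a1 c c 1 (b1 * w) (1 - a1) (- a1) (- c))"
    using admits_scale[OF A, of 1 "1 / w"] w0 False w by (simp add: power_divide c_def)
  hence "admits (msc (a1 - c^2) 0 0 1 (b1 * w - c * (1 - a1 - a1) - c^3 + c * (a1 - c^2))
      (1 - (a1 - c^2)) (- (a1 - c^2)) 0)"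
    by (rule admits_shift[where t = "- c"]) algebra+
  thus ?thesis using mem_families(6) unfolding A6_def by blast
next
  case a4: True
  show ?thesis
  proof (cases "a = 0")
    case False
    define h where "h = a1 / 2"
    have h: "a1 = 2 * h" using two by (simp add: h_def)
    have "admits (msc a1 1 1 0 (b1 * a) (1 - a1) (- a1) (- 1))"
      using admits_scale[OF A, of 1 "1 / a"] a4 False by simp
    hence "admits (msc 0 1 1 0 (b1 * a - h * (1 - a1 - a1) - h^2) 1 0 (- 1))"
      by (rule admits_shift[where t = "- h"], unfold h) algebra+
    thus ?thesis using mem_families(7) unfolding A7_def by blast
  next
    case a: True
    have A': "admits (msc a1 0 0 0 b1 (1 - a1) (- a1) 0)" using A a4 a by simp
    consider "3 * a1 \<noteq> 1" | "3 * a1 = 1" "b1 = 0" | "3 * a1 = 1" "b1 \<noteq> 0" by blast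
    thus ?thesis
    proof cases
      case 1
      define t where "t = b1 / (3 * a1 - 1)"
      have t: "t * (3 * a1 - 1) = b1" unfolding t_def using 1 by simp
      have "b1 + t * (1 - a1 + - a1) - t * a1 = b1 - t * (3 * a1 - 1)" by algebra
      also have "\<dots> = 0" using t by simp
      finally have "admits (msc a1 0 0 0 0 (1 - a1) (- a1) 0)"
        by (intro admits_shift[OF A', where t = t]) simp_all
      thus ?thesis using mem_families(8) unfolding A8_def by blast
    next
      case 2
      thus ?thesis using A' mem_families(8) unfolding A8_def by blast
    next
      case 3
      have third: "x = y / 3" if "3 * x = y" for x y :: 'a
        using that three by (auto simp: nonzero_eq_divide_eq mult.commute)
      have "3 * (1 - a1) = 2" using 3(1) by algebra
      hence "a1 = 1 / 3" "1 - a1 = 2 / 3" using 3(1) third by blast+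
      moreover have "admits (msc a1 0 0 0 1 (1 - a1) (- a1) 0)"
        using admits_scale[OF A', of 1 b1] 3 by simp
      ultimately show ?thesis using mem_families(9) unfolding A9_def by metis
    qed
  qed
qed

text \<open>Here the binary cubic form determines the product; the basis is moved so that \<open>e2\<close> spans
  a line on which the form vanishes.\<close>

lemma admits_families_of_traceless:
  assumes A: "admits (msc a1 a a a4 b1 (- a1) (- a1) (- a))"
    and nz: "a1 \<noteq> 0 \<or> a \<noteq> 0 \<or> a4 \<noteq> 0 \<or> b1 \<noteq> 0"
  shows "\<exists>B\<in>families. admits B"
proof -
  \<comment> \<open>Here \<open>e2\<close> spans a simple zero of the form. The cubic is brought to
    \<open>3 * y^2 - c\<close>, and only whether \<open>c\<close> vanishes matters, since
    \<open>c\<close> can be scaled by squares.\<close>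
  have nonflat: "\<exists>B\<in>families. admits B" if A: "admits (msc a1 a a 0 b1 (- a1) (- a1) (- a))" and a: "a \<noteq> 0"
    for a1 a b1
  proof -
    define h where "h = a1 / 2"
    have h: "a1 = 2 * h" using two by (simp add: h_def)
    have "admits (msc a1 1 1 0 (b1 * a) (- a1) (- a1) (- 1))"
      using admits_scale[OF A, of 1 "1 / a"] a by simp
    hence "admits (msc 0 1 1 0 (b1 * a + h * (a1 + a1) - h^2) 0 0 (- 1))"
      by (rule admits_shift[where t = "- h"], unfold h) algebra+
    then obtain c where c: "admits (msc 0 1 1 0 c 0 0 (- 1))" by blast
    show ?thesis
    proof (cases "c = 0")
      case True
      thus ?thesis using c mem_families(10) unfolding A10_def by blast
    next
      case False
      obtain w where w: "w^2 = c" using sqrt by blast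
      hence "w \<noteq> 0" using False by auto
      hence "admits (msc 0 1 1 0 1 0 0 (- 1))"
        using admits_scale[OF c, of "1 / w" 1] w False by (simp add: power_divide)
      thus ?thesis using mem_families(11) unfolding A11_def by blast
    qed
  qed
  have flat: "\<exists>B\<in>families. admits B"
    if A: "admits (msc a1 a a 0 b1 (- a1) (- a1) (- a))" and nz: "a1 \<noteq> 0 \<or> a \<noteq> 0 \<or> b1 \<noteq> 0"
    for a1 a b1
  proof -
    consider "a \<noteq> 0" | "a = 0" "a1 \<noteq> 0" | "a = 0" "a1 = 0" "b1 \<noteq> 0" using nz by blast
    thus ?thesis
    proof cases
      case 1
      thus ?thesis using nonflat A by blast
    next
      case 2
      \<comment> \<open>The line of \<open>e2\<close> is now a double zero. The shift moves the
        simple zero to the line of \<open>e1\<close>, and the swap then puts it on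
        \<open>e2\<close>, which is the preceding situation.\<close>
      define t where "t = b1 / (3 * a1)"
      have t: "t * (3 * a1) = b1" unfolding t_def using 2 three by simp
      have "b1 + t * (- a1 + - a1) - t * a1 = b1 - t * (3 * a1)" by algebra
      also have "\<dots> = 0" using t by simp
      finally have "admits (msc a1 0 0 0 0 (- a1) (- a1) 0)"
        using 2 by (intro admits_shift[OF A, where t = t]) simp_all
      from nonflat[of 0 "- a1" 0] admits_swap[OF this] 2 show ?thesis by simp
    next
      case 3
      have "admits (msc 0 0 0 0 1 0 0 0)" using admits_scale[OF A, of 1 b1] 3 by simp
      thus ?thesis using mem_families(12) unfolding A12_def by blast
    qed
  qed
  show ?thesis
  proof (cases "a4 = 0")
    case True
    thus ?thesis using flat A nz by blast
  next
    case False
    \<comment> \<open>The vector \<open>e1 + y e2\<close> spans a zero of the form, so the shift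
      clears \<open>b1\<close> and the swap moves this zero to the second basis vector. The nonzero
      \<open>a4\<close> then stands in the place of \<open>b1\<close>, as \<open>flat\<close>
      requires.\<close>
    then obtain y where y: "a4 * y^3 + (3 * a) * y^2 + (3 * a1) * y + (- b1) = 0" using cubic by blast
    have d1: "0 = b1 + y * (- a1 + - a1) + y^2 * - a - y * (a1 + y * (a + a) + y^2 * a4)"
    proof -
      have "b1 + y * (- a1 + - a1) + y^2 * - a - y * (a1 + y * (a + a) + y^2 * a4) =
          - (a4 * y^3 + (3 * a) * y^2 + (3 * a1) * y + (- b1))" by algebra
      also have "\<dots> = 0" by (simp only: y minus_zero)
      finally show ?thesis by (rule sym)
    qed
    have "admits (msc (a1 + y * (a + a) + y^2 * a4) (a + y * a4) (a + y * a4) a4 0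
      (- (a1 + y * (a + a) + y^2 * a4)) (- (a1 + y * (a + a) + y^2 * a4)) (- (a + y * a4)))"
      by (rule admits_shift[OF A, where t = y], (rule refl d1)+, algebra+)
    from admits_swap[OF this]
    have "admits (msc (- (a + y * a4)) (- (a1 + y * (a + a) + y^2 * a4))
        (- (a1 + y * (a + a) + y^2 * a4)) 0 a4 (- (- (a + y * a4))) (- (- (a + y * a4)))
        (- (- (a1 + y * (a + a) + y^2 * a4))))"
      by (simp only: minus_minus)
    from flat[OF this] False show ?thesis by blast
  qed
qed

lemma nontrivial_msc_nonzero:
  assumes "nontrivial" "has_msc e1 e2 A"
  shows "A \<noteq> 0"
proof
  assume "A = 0"
  have "mul u v = 0" for u v
  proof -
    obtain x1 x2 y1 y2 where "u = smul x1 e1 + smul x2 e2" "v = smul y1 e1 + smul y2 e2"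
      using assms(2) unfolding has_msc_def coord_basis_def by metis
    thus ?thesis using mul_lincomb[OF assms(2)] \<open>A = 0\<close> by simp
  qed
  thus False using assms(1) unfolding nontrivial_def by blast
qed

lemma admits_families:
  assumes nt: "nontrivial" and A: "admits A"
  shows "\<exists>B\<in>families. admits B"
proof -
  obtain a1 a2 a3 a4 b1 b2 b3 b4 where eta: "A = msc a1 a2 a3 a4 b1 b2 b3 b4"
    using msc_eta[of A] by metis
  have A: "admits (msc a1 a2 a3 a4 b1 b2 b3 b4)" using A eta by simp
  define l1 l2 r1 r2 where "l1 = a1 + b2" and "l2 = a3 + b4" and "r1 = a1 + b3" and "r2 = a2 + b4"
  note change = admits_change_traces[OF A, folded l1_def l2_def r1_def r2_def]
  \<comment> \<open>A nonzero linear form with coordinates \<open>x, y\<close> gets the coordinates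
    1, 0 in a suitable basis.\<close>
  have complete: "\<exists>p q r s. p * x + q * y = 1 \<and> r * x + s * y = 0 \<and> p * s - q * r \<noteq> 0"
    if "x \<noteq> 0 \<or> y \<noteq> 0" for x y :: 'a
  proof (cases "x = 0")
    case True
    with that show ?thesis
      by (intro exI[of _ 0] exI[of _ "1 / y"] exI[of _ 1]) simp
  next
    case False
    thus ?thesis
      by (intro exI[of _ "1 / x"] exI[of _ 0] exI[of _ "- y"] exI[of _ x]) simp
  qed
  consider (indep) "l1 * r2 - l2 * r1 \<noteq> 0"
    | (right) "l1 * r2 - l2 * r1 = 0" "r1 \<noteq> 0 \<or> r2 \<noteq> 0"
    | (left) "r1 = 0" "r2 = 0" "l1 \<noteq> 0 \<or> l2 \<noteq> 0"
    | (zero) "r1 = 0" "r2 = 0" "l1 = 0" "l2 = 0" by blast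
  thus ?thesis
  proof cases
    case indep
    define D where "D = l1 * r2 - l2 * r1"
    have D: "D \<noteq> 0" using indep D_def by simp
    define i where "i = 1 / D"
    have i: "i * D = 1" "i \<noteq> 0" using D by (simp_all add: i_def)
    \<comment> \<open>The coefficients form the dual basis: the right trace is 1 and the left trace
      0 on the new first vector, and conversely on the second.\<close>
    have eqs: "- (l2 * i) * r1 + l1 * i * r2 = 1" "- (l2 * i) * l1 + l1 * i * l2 = 0"
      "r2 * i * r1 + - (r1 * i) * r2 = 0" "r2 * i * l1 + - (r1 * i) * l2 = 1"
      and det: "- (l2 * i) * - (r1 * i) - l1 * i * (r2 * i) = - i"
      using i(1) unfolding D_def by algebra+
    have "- (l2 * i) * - (r1 * i) - l1 * i * (r2 * i) \<noteq> 0" unfolding det using i(2) by simp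
    from change[OF this] obtain c1 c2 c3 c4 d1 d2 d3 d4 where c: "admits (msc c1 c2 c3 c4 d1 d2 d3 d4)"
      and "c1 + d2 = 0" "c3 + d4 = 1" "c1 + d3 = 1" "c2 + d4 = 0"
      unfolding eqs by metis
    hence "d2 = - c1" "d3 = - c1 + 1" "c3 = c2 + 1" "d4 = - c2" by algebra+
    with c have "admits (A1 c1 c2 c4 d1)" by (simp add: A1_def)
    thus ?thesis using mem_families(1) by blast
  next
    case right
    then obtain p q r s where pqrs: "p * r1 + q * r2 = 1" "r * r1 + s * r2 = 0" "p * s - q * r \<noteq> 0"
      using complete by blast
    \<comment> \<open>The forms are dependent and the right trace is nonzero, so the left trace
      vanishes on its kernel.\<close>
    have "r * l1 + s * l2 = 0"
      using right(1) pqrs(1,2) by algebra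
    with change[OF pqrs(3)] pqrs obtain c1 c2 c3 c4 d1 d2 d3 d4
      where c: "admits (msc c1 c2 c3 c4 d1 d2 d3 d4)"
        and "c3 + d4 = 0" "c1 + d3 = 1" "c2 + d4 = 0" by metis
    hence "d3 = 1 - c1" "c3 = c2" "d4 = - c2" by algebra+
    thus ?thesis using admits_families_of_right_trace c by blast
  next
    case left
    then obtain p q r s where pqrs: "p * l1 + q * l2 = 1" "r * l1 + s * l2 = 0" "p * s - q * r \<noteq> 0"
      using complete by blast
    have "p * r1 + q * r2 = 0" "r * r1 + s * r2 = 0" using left by simp_all
    with change[OF pqrs(3)] pqrs obtain c1 c2 c3 c4 d1 d2 d3 d4
      where c: "admits (msc c1 c2 c3 c4 d1 d2 d3 d4)"
        and "c1 + d2 = 1" "c3 + d4 = 0" "c1 + d3 = 0" "c2 + d4 = 0" by metis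
    hence "d2 = 1 - c1" "d3 = - c1" "c3 = c2" "d4 = - c2" by algebra+
    thus ?thesis using admits_families_of_left_trace c by blast
  next
    case zero
    hence eqs: "b2 = - a1" "b3 = - a1" "a3 = a2" "b4 = - a2"
      unfolding l1_def l2_def r1_def r2_def by algebra+
    have "A \<noteq> 0" using nontrivial_msc_nonzero nt assms(2) unfolding admits_def by blast
    hence "a1 \<noteq> 0 \<or> a2 \<noteq> 0 \<or> a4 \<noteq> 0 \<or> b1 \<noteq> 0"
      unfolding eta eqs by (auto simp: vec_eq_iff forall_2 forall_4)
    thus ?thesis using admits_families_of_traceless A unfolding eqs by blast
  qed
qed

end


section \<open>Counting subalgebras in the normal forms\<close>

lemma card_roots_linear:
  fixes a b :: "'a::field"
  assumes "a \<noteq> 0"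
  shows "card {y. a * y + b = 0} = 1"
proof -
  have "{y. a * y + b = 0} = {- b / a}"
    using assms by (auto simp: field_simps eq_neg_iff_add_eq_0)
  thus ?thesis by simp
qed

text \<open>The additional zero is the line spanned by \<open>e2\<close>; finiteness rules out the
  default value 0 of \<open>card\<close>.\<close>

lemma card_proj_roots_leading_zero:
  assumes "A$1$4 = (0::'a::field)" "finite {y. msc_cubic A y = 0}"
  shows "card (proj_roots A) = card {y. msc_cubic A y = 0} + 1"
  using assms by (auto simp: proj_roots_def card_image)

lemma card_proj_roots_leading_nonzero:
  assumes "A$1$4 \<noteq> (0::'a::field)"
  shows "card (proj_roots A) = card {y. msc_cubic A y = 0}"
  using assms by (simp add: proj_roots_def card_image)


text \<open>The trivial coefficients and the signs are kept so that the right-hand sides match the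
  general patterns of degree three, two and one literally.\<close>

lemma msc_cubic_families:
  "msc_cubic (A1 \<alpha>1 \<alpha>2 \<alpha>4 \<beta>1) y = \<alpha>4 * y^3 + (3 * \<alpha>2 + 1) * y^2 + (3 * \<alpha>1 - 1) * y + - \<beta>1"
  "msc_cubic (A2 \<alpha>1 \<beta>1 \<beta>2) y = 1 * y^3 + 0 * y^2 + (2 * \<alpha>1 - \<beta>2 - 1) * y + - \<beta>1"
  "msc_cubic (A3 \<beta>1 \<beta>2) y = 3 * y^2 + - (\<beta>2 + 1) * y + - \<beta>1"
  "msc_cubic (A4 \<alpha>1 \<beta>2) y = (2 * \<alpha>1 - 1 - \<beta>2) * y + 0"
  "msc_cubic (A5 \<alpha>1) y = - 1"
  "msc_cubic (A6 \<alpha>1 \<beta>1) y = 1 * y^3 + 0 * y^2 + (3 * \<alpha>1 - 1) * y + - \<beta>1"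
  "msc_cubic (A7 \<beta>1) y = 3 * y^2 + - 1 * y + - \<beta>1"
  "msc_cubic (A8 \<alpha>1) y = (3 * \<alpha>1 - 1) * y + 0"
  "msc_cubic A10 y = 3 * y^2 + 0 * y + 0"
  "msc_cubic A11 y = 3 * y^2 + 0 * y + - 1"
  "msc_cubic A12 y = - 1"
  unfolding msc_cubic_def A1_def A2_def A3_def A4_def A5_def A6_def A7_def A8_def A10_def A11_def
    A12_def msc_nth by algebra+

lemma leading_families:
  "A1 \<alpha>1 \<alpha>2 \<alpha>4 \<beta>1 $ 1 $ 4 = \<alpha>4" "A2 \<alpha>1 \<beta>1 \<beta>2 $ 1 $ 4 = 1" "A3 \<beta>1 \<beta>2 $ 1 $ 4 = 0"
  "A4 \<alpha>1 \<beta>2 $ 1 $ 4 = 0" "A5 \<alpha>1 $ 1 $ 4 = 0" "A6 \<alpha>1 \<beta>1 $ 1 $ 4 = 1" "A7 \<beta>1 $ 1 $ 4 = 0"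
  "A8 \<alpha>1 $ 1 $ 4 = 0" "A9 $ 1 $ 4 = 0" "A10 $ 1 $ 4 = 0" "A11 $ 1 $ 4 = 0" "A12 $ 1 $ 4 = 0"
  by (simp_all add: A1_def A2_def A3_def A4_def A5_def A6_def A7_def A8_def A9_def A10_def
      A11_def A12_def)

section \<open>Numbers of zeros in the single families\<close>

context root_closed_field
begin

text \<open>Turns side conditions with fractions into the vanishing of coefficients of the
  cubics.\<close>

lemma third_iff: "x = 1 / 3 \<longleftrightarrow> 3 * x - 1 = 0" "x = - (1 / 3) \<longleftrightarrow> 3 * x + 1 = 0" for x :: 'a
proof -
  have *: "x = y / 3 \<longleftrightarrow> 3 * x = y" for x y :: 'a
    using three by (auto simp: nonzero_eq_divide_eq mult.commute)
  show "x = 1 / 3 \<longleftrightarrow> 3 * x - 1 = 0" unfolding * by simp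
  have "- (1 / 3) = (- 1 / 3 :: 'a)" by simp
  thus "x = - (1 / 3) \<longleftrightarrow> 3 * x + 1 = 0" using *[of x "- 1"] by (simp add: eq_neg_iff_add_eq_0)
qed

lemma mult_three_third: "3 * (w / 3) = (w::'a)"
  using three by simp

lemma twelve: "(12::'a) \<noteq> 0"
proof -
  have "(2::'a) * (2 * 3) \<noteq> 0" using two three by (simp only: mult_eq_0_iff simp_thms)
  thus ?thesis by simp
qed

lemma nine: "(9::'a) \<noteq> 0"
proof -
  have "(3::'a) * 3 \<noteq> 0" using three by (simp only: mult_eq_0_iff simp_thms)
  thus ?thesis by simp
qed

lemma twenty_seven: "(27::'a) \<noteq> 0"
proof -
  have "(3::'a) * 9 \<noteq> 0" using three nine by (simp only: mult_eq_0_iff simp_thms)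
  thus ?thesis by simp
qed

lemma card_proj_roots_quadratic:
  assumes "A$1$4 = (0::'a)" "\<And>y. msc_cubic A y = b * y^2 + c * y + d" "b \<noteq> 0"
  shows "card (proj_roots A) = (if c^2 - 4 * b * d = 0 then 2 else 3)"
proof -
  have "card {y. msc_cubic A y = 0} = (if c^2 - 4 * b * d = 0 then 1 else 2)"
    unfolding assms(2) by (rule card_roots_quadratic[OF assms(3)])
  moreover from this have "finite {y. msc_cubic A y = 0}"
    by (metis card.infinite zero_neq_one zero_neq_numeral)
  ultimately show ?thesis using card_proj_roots_leading_zero[OF assms(1)] by simp
qed

lemma card_proj_roots_linear:
  assumes "A$1$4 = (0::'a)" "\<And>y. msc_cubic A y = c * y + d" "c \<noteq> 0"
  shows "card (proj_roots A) = 2"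
proof -
  have "card {y. msc_cubic A y = 0} = 1"
    unfolding assms(2) by (rule card_roots_linear[OF assms(3)])
  moreover from this have "finite {y. msc_cubic A y = 0}"
    by (metis card.infinite zero_neq_one)
  ultimately show ?thesis using card_proj_roots_leading_zero[OF assms(1)] by simp
qed

lemma card_proj_roots_const:
  assumes "A$1$4 = (0::'a)" "\<And>y. msc_cubic A y \<noteq> 0"
  shows "card (proj_roots A) = 1"
  using assms by (simp add: proj_roots_def)

lemma infinite_proj_roots:
  assumes "\<And>y. msc_cubic A y = (0::'a)"
  shows "infinite (proj_roots A)"
  using assms infinite_field
  by (simp add: proj_roots_def finite_image_iff)

lemma A1_cubic:
  fixes \<alpha>1 \<alpha>2 \<alpha>4 \<beta>1 :: 'a
  assumes a: "\<alpha>4 \<noteq> 0"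
  defines "P \<equiv> msc_cubic (A1 \<alpha>1 \<alpha>2 \<alpha>4 \<beta>1) (y_m1 rt \<alpha>1 \<alpha>2 \<alpha>4) *
      msc_cubic (A1 \<alpha>1 \<alpha>2 \<alpha>4 \<beta>1) (y_p1 rt \<alpha>1 \<alpha>2 \<alpha>4)"
  shows "card (proj_roots (A1 \<alpha>1 \<alpha>2 \<alpha>4 \<beta>1)) =
      (if P \<noteq> 0 then 3 else if \<alpha>1 = (3*\<alpha>2 + 1)^2 / (9*\<alpha>4) + 1/3 then 1 else 2)"
    and "\<alpha>1 = (3*\<alpha>2 + 1)^2 / (9*\<alpha>4) + 1/3 \<Longrightarrow>
      P = 0 \<longleftrightarrow> \<beta>1 = - ((3*\<alpha>2 + 1)^3) / (27*\<alpha>4^2)"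
proof -
  define w where "w = rt ((3*\<alpha>2 + 1)^2 - 3*\<alpha>4*(3*\<alpha>1 - 1))"
  have w: "w^2 = (3*\<alpha>2 + 1)^2 - 3*\<alpha>4*(3*\<alpha>1 - 1)" unfolding w_def by (rule rt)
  have a3: "3 * \<alpha>4 \<noteq> 0" using a three by simp
  have u: "3*\<alpha>4 * y_m1 rt \<alpha>1 \<alpha>2 \<alpha>4 = - (3*\<alpha>2 + 1) - w"
    and v: "3*\<alpha>4 * y_p1 rt \<alpha>1 \<alpha>2 \<alpha>4 = - (3*\<alpha>2 + 1) + w"
    unfolding y_m1_def y_p1_def w_def [symmetric] times_divide_eq_right
    by (rule nonzero_mult_div_cancel_left[OF a3])+
  note main = card_roots_cubic_sqrt[OF a w u v,
      where d = "- \<beta>1", folded msc_cubic_families(1), folded P_def]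
  \<comment> \<open>With denominators cleared, the condition on \<open>\<alpha>1\<close> is
    \<open>b^2 = 3 * a * c\<close>: the two critical points coincide.\<close>
  have triple: "\<alpha>1 = (3*\<alpha>2 + 1)^2 / (9*\<alpha>4) + 1/3 \<longleftrightarrow> (3*\<alpha>2 + 1)^2 = 3*\<alpha>4*(3*\<alpha>1 - 1)"
  proof -
    have "\<alpha>1 = (3*\<alpha>2 + 1)^2 / (9*\<alpha>4) + 1/3 \<longleftrightarrow> \<alpha>1 - 1/3 = (3*\<alpha>2 + 1)^2 / (9*\<alpha>4)"
      by (auto simp: algebra_simps)
    also have "\<dots> \<longleftrightarrow> (\<alpha>1 - 1/3) * (9*\<alpha>4) = (3*\<alpha>2 + 1)^2"
      using a nine by (intro nonzero_eq_divide_eq) simp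
    also have "(\<alpha>1 - 1/3) * (9*\<alpha>4) = 3*\<alpha>4*(3*\<alpha>1 - 1)"
    proof -
      have "x * (9 * y) = 3 * y * (3 * x)" for x y :: 'a by algebra
      thus ?thesis by (simp only: right_diff_distrib mult_three_third)
    qed
    finally show ?thesis by metis
  qed
  show "card (proj_roots (A1 \<alpha>1 \<alpha>2 \<alpha>4 \<beta>1)) =
      (if P \<noteq> 0 then 3 else if \<alpha>1 = (3*\<alpha>2 + 1)^2 / (9*\<alpha>4) + 1/3 then 1 else 2)"
    unfolding triple using main(1) a
    by (simp add: card_proj_roots_leading_nonzero leading_families)
  assume "\<alpha>1 = (3*\<alpha>2 + 1)^2 / (9*\<alpha>4) + 1/3"
  hence "P = 0 \<longleftrightarrow> 27 * \<alpha>4^2 * - \<beta>1 = (3*\<alpha>2 + 1)^3" using main(2) triple by blast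
  also have "\<dots> \<longleftrightarrow> \<beta>1 * (27 * \<alpha>4^2) = - ((3*\<alpha>2 + 1)^3)" by algebra
  also have "\<dots> \<longleftrightarrow> \<beta>1 = - ((3*\<alpha>2 + 1)^3) / (27*\<alpha>4^2)"
    using a twenty_seven by (intro nonzero_eq_divide_eq [symmetric]) simp
  finally show "P = 0 \<longleftrightarrow> \<beta>1 = - ((3*\<alpha>2 + 1)^3) / (27*\<alpha>4^2)" .
qed

lemma zero_eq_three_mult_iff: "0^2 = 3 * 1 * c \<longleftrightarrow> c = (0::'a)"
  using three by auto

lemma A2_cubic:
  fixes \<alpha>1 \<beta>1 \<beta>2 :: 'a
  defines "P \<equiv> msc_cubic (A2 \<alpha>1 \<beta>1 \<beta>2) (y_m2 rt \<alpha>1 \<beta>2) * msc_cubic (A2 \<alpha>1 \<beta>1 \<beta>2) (y_p2 rt \<alpha>1 \<beta>2)"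
  shows "card (proj_roots (A2 \<alpha>1 \<beta>1 \<beta>2)) = (if P \<noteq> 0 then 3 else if \<beta>2 = 2*\<alpha>1 - 1 then 1 else 2)"
    and "\<beta>2 = 2*\<alpha>1 - 1 \<Longrightarrow> P = 0 \<longleftrightarrow> \<beta>1 = 0"
proof -
  define w where "w = rt (3*(1 + \<beta>2 - 2*\<alpha>1))"
  have "w^2 = 3*(1 + \<beta>2 - 2*\<alpha>1)" unfolding w_def by (rule rt)
  hence w: "w^2 = 0^2 - 3*1*(2*\<alpha>1 - \<beta>2 - 1)" by (simp add: algebra_simps)
  have u: "3*1 * y_m2 rt \<alpha>1 \<beta>2 = - 0 - w" and v: "3*1 * y_p2 rt \<alpha>1 \<beta>2 = - 0 + w"
    by (simp_all add: y_m2_def y_p2_def w_def mult_three_third del: times_divide_eq_right)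
  note main = card_roots_cubic_sqrt[OF one_neq_zero w u v,
      where d = "- \<beta>1", folded msc_cubic_families(2), folded P_def]
  have triple: "0^2 = 3*1*(2*\<alpha>1 - \<beta>2 - 1) \<longleftrightarrow> \<beta>2 = 2*\<alpha>1 - 1"
    unfolding zero_eq_three_mult_iff by (auto simp: algebra_simps)
  show "card (proj_roots (A2 \<alpha>1 \<beta>1 \<beta>2)) = (if P \<noteq> 0 then 3 else if \<beta>2 = 2*\<alpha>1 - 1 then 1 else 2)"
    using main(1) unfolding triple
    by (simp add: card_proj_roots_leading_nonzero leading_families)
  assume "\<beta>2 = 2*\<alpha>1 - 1"
  thus "P = 0 \<longleftrightarrow> \<beta>1 = 0" using main(2) twenty_seven unfolding triple by simp
qed

lemma A6_cubic:
  fixes \<alpha>1 \<beta>1 :: 'a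
  defines "P \<equiv> msc_cubic (A6 \<alpha>1 \<beta>1) (y_m6 rt \<alpha>1) * msc_cubic (A6 \<alpha>1 \<beta>1) (y_p6 rt \<alpha>1)"
  shows "card (proj_roots (A6 \<alpha>1 \<beta>1)) = (if P \<noteq> 0 then 3 else if \<alpha>1 = 1/3 then 1 else 2)"
    and "\<alpha>1 = 1/3 \<Longrightarrow> P = 0 \<longleftrightarrow> \<beta>1 = 0"
proof -
  \<comment> \<open>The sign is negative because \<open>y_m6\<close> carries the positive square
    root, so \<open>3 * y_m6\<close> must equal \<open>- w\<close>.\<close>
  define w where "w = - rt (3*(1 - 3*\<alpha>1))"
  have "w^2 = 3*(1 - 3*\<alpha>1)" unfolding w_def power2_minus by (rule rt)
  hence w: "w^2 = 0^2 - 3*1*(3*\<alpha>1 - 1)" by (simp add: algebra_simps)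
  have u: "3*1 * y_m6 rt \<alpha>1 = - 0 - w" and v: "3*1 * y_p6 rt \<alpha>1 = - 0 + w"
    by (simp_all add: y_m6_def y_p6_def w_def mult_three_third del: times_divide_eq_right)
  note main = card_roots_cubic_sqrt[OF one_neq_zero w u v,
      where d = "- \<beta>1", folded msc_cubic_families(6), folded P_def]
  have triple: "0^2 = 3*1*(3*\<alpha>1 - 1) \<longleftrightarrow> \<alpha>1 = 1/3"
    unfolding third_iff zero_eq_three_mult_iff ..
  show "card (proj_roots (A6 \<alpha>1 \<beta>1)) = (if P \<noteq> 0 then 3 else if \<alpha>1 = 1/3 then 1 else 2)"
    using main(1) unfolding triple
    by (simp add: card_proj_roots_leading_nonzero leading_families)
  assume "\<alpha>1 = 1/3"
  thus "P = 0 \<longleftrightarrow> \<beta>1 = 0" using main(2) twenty_seven unfolding triple by simp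
qed

lemma A1_quadratic:
  assumes "\<alpha>2 \<noteq> - (1/3::'a)"
  shows "card (proj_roots (A1 \<alpha>1 \<alpha>2 0 \<beta>1)) =
    (if (3*\<alpha>1 - 1)^2 + 4*(3*\<alpha>2 + 1)*\<beta>1 = 0 then 2 else 3)"
  using card_proj_roots_quadratic[OF _ _ assms[unfolded third_iff], of "A1 \<alpha>1 \<alpha>2 0 \<beta>1" "3*\<alpha>1 - 1" "- \<beta>1"]
  by (simp add: leading_families msc_cubic_families)

lemma A1_linear:
  assumes "\<alpha>1 \<noteq> (1/3::'a)"
  shows "card (proj_roots (A1 \<alpha>1 (- (1/3)) 0 \<beta>1)) = 2"
proof -
  have "3 * (- (1/3)) + 1 = (0::'a)" using third_iff(2) by blast
  thus ?thesis
    using assms unfolding third_iff(1)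
    by (intro card_proj_roots_linear[where c = "3*\<alpha>1 - 1" and d = "- \<beta>1"])
      (simp_all only: leading_families msc_cubic_families mult_zero_left add_0 not_False_eq_True simp_thms)
qed

lemma A1_flat: "msc_cubic (A1 (1/3) (- (1/3)) 0 \<beta>1) y = - (\<beta>1::'a)"
proof -
  have "3 * (- (1/3)) + 1 = (0::'a)" "3 * (1/3) - 1 = (0::'a)" using third_iff by blast+
  thus ?thesis by (simp only: msc_cubic_families mult_zero_left add_0)
qed

lemma A3_card:
  "card (proj_roots (A3 \<beta>1 \<beta>2)) = (if (\<beta>2 + 1)^2 + 12*\<beta>1 = (0::'a) then 2 else 3)"
proof -
  have "(- (\<beta>2 + 1))^2 - 4 * 3 * - \<beta>1 = (\<beta>2 + 1)^2 + 12*\<beta>1" by algebra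
  thus ?thesis
    using card_proj_roots_quadratic[OF leading_families(3) msc_cubic_families(3) three, of \<beta>1 \<beta>2]
    by (simp only:)
qed

lemma A4_card:
  assumes "\<beta>2 \<noteq> 2*\<alpha>1 - (1::'a)"
  shows "card (proj_roots (A4 \<alpha>1 \<beta>2)) = 2"
  using assms by (intro card_proj_roots_linear[OF leading_families(4) msc_cubic_families(4)]) auto

lemma A7_card: "card (proj_roots (A7 \<beta>1)) = (if 12*\<beta>1 + 1 = (0::'a) then 2 else 3)"
proof -
  have "(- 1)^2 - 4 * 3 * - \<beta>1 = 12*\<beta>1 + 1" by algebra
  thus ?thesis
    using card_proj_roots_quadratic[OF leading_families(7) msc_cubic_families(7) three, of \<beta>1]
    by (simp only:)
qed

lemma A8_card:
  assumes "\<alpha>1 \<noteq> (1/3::'a)"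
  shows "card (proj_roots (A8 \<alpha>1)) = 2"
  using assms unfolding third_iff
  by (intro card_proj_roots_linear[OF leading_families(8) msc_cubic_families(8)])

lemma A10_card: "card (proj_roots (A10::'a^4^2)) = 2"
  using card_proj_roots_quadratic[OF leading_families(10) msc_cubic_families(9) three] by simp

lemma A11_card: "card (proj_roots (A11::'a^4^2)) = 3"
  using card_proj_roots_quadratic[OF leading_families(11) msc_cubic_families(10) three] twelve by simp

lemma A9_cubic: "msc_cubic (A9::'a^4^2) y = - 1"
proof -
  have "(2/3::'a) = 1/3 + 1/3" by (simp only: add_divide_distrib [symmetric] one_add_one)
  thus ?thesis unfolding msc_cubic_def A9_def msc_nth by simp
qed

lemma twelfth_iff: "x = - (y / 12) \<longleftrightarrow> y + 12 * x = 0" for x y :: 'a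
proof -
  have "x = - (y / 12) \<longleftrightarrow> x = - y / 12" by simp
  also have "\<dots> \<longleftrightarrow> x * 12 = - y" by (rule nonzero_eq_divide_eq[OF twelve])
  finally show ?thesis by (simp add: eq_neg_iff_add_eq_0 ac_simps)
qed

lemma twelfth_cancel: "y + 12 * - (y / 12) = (0::'a)" "12 * - (1 / 12) + 1 = (0::'a)"
  using twelfth_iff by (blast, metis add.commute twelfth_iff)

section \<open>Numbers of zeros in the four lists\<close>

text \<open>Either the cubic is a nonzero constant and only the line of \<open>e2\<close> remains,
  or it has degree three and a triple zero.\<close>

lemma card_one_list:
  assumes "A \<in> (one_list :: ('a^4^2) set)"
  shows "card (proj_roots A) = 1"
proof -
  have const: "card (proj_roots A) = 1" if "A$1$4 = (0::'a)" "\<And>y. msc_cubic A y = c" "c \<noteq> 0" for A c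
    using that by (intro card_proj_roots_const) simp_all
  have 1: "card (proj_roots (A1 (1/3) (- (1/3)) 0 \<beta>1)) = 1" if "\<beta>1 \<noteq> (0::'a)" for \<beta>1
    using that by (intro const[OF leading_families(1) A1_flat]) simp
  have 2: "card (proj_roots (A5 \<alpha>1)) = 1" for \<alpha>1 :: 'a
    by (intro const[OF leading_families(5) msc_cubic_families(5)]) simp
  have 3: "card (proj_roots (A9 :: 'a^4^2)) = 1"
    by (intro const[OF leading_families(9) A9_cubic]) simp
  have 4: "card (proj_roots (A12 :: 'a^4^2)) = 1"
    by (intro const[OF leading_families(12) msc_cubic_families(11)]) simp
  have 5: "card (proj_roots (A1 \<alpha>1 \<alpha>2 \<alpha>4 \<beta>1)) = 1"
    if "\<alpha>4 \<noteq> 0" "\<alpha>1 = (3*\<alpha>2 + 1)^2 / (9*\<alpha>4) + 1/3" "\<beta>1 = - ((3*\<alpha>2 + 1)^3) / (27*\<alpha>4^2)"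
    for \<alpha>1 \<alpha>2 \<alpha>4 \<beta>1 :: 'a
    unfolding A1_cubic(1)[OF that(1)] using iffD2[OF A1_cubic(2)[OF that(1,2)] that(3)] that(2)
    by (simp only: simp_thms if_True if_False)
  have 6: "card (proj_roots (A2 \<alpha>1 0 (2*\<alpha>1 - 1))) = 1" for \<alpha>1 :: 'a
    unfolding A2_cubic(1) using A2_cubic(2)[OF refl] by (simp only: simp_thms if_True if_False)
  have 7: "card (proj_roots (A6 (1/3) (0::'a))) = 1"
    unfolding A6_cubic(1) using A6_cubic(2)[OF refl] by (simp only: simp_thms if_True if_False)
  show ?thesis
    using assms unfolding one_list_def
  proof (elim UnE)
  qed (elim CollectE exE conjE singletonE, hypsubst, simp only: 1 2 3 4 5 6 7 simp_thms)+
qed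

text \<open>Three sources: degree three with a double but no triple zero; degree two with a double
  zero, together with the line of \<open>e2\<close>; degree one, together with that line.\<close>

lemma card_two_list:
  assumes "A \<in> two_list rt"
  shows "card (proj_roots A) = 2"
  using assms unfolding two_list_def
proof (elim UnE)
qed (elim CollectE exE conjE singletonE, hypsubst,
    simp only: A1_cubic(1) A1_quadratic A1_linear A2_cubic(1) A3_card A4_card A6_cubic(1)
      A7_card A8_card A10_card twelfth_cancel simp_thms if_True if_False)+

lemma card_three_list:
  assumes "A \<in> three_list rt"
  shows "card (proj_roots A) = 3"
proof -
  have "card (proj_roots (A1 \<alpha>1 \<alpha>2 0 \<beta>1)) = 3"
    if "(3*\<alpha>2 + 1) * ((3*\<alpha>1 - 1)^2 + 4*(3*\<alpha>2 + 1)*\<beta>1) \<noteq> 0" for \<alpha>1 \<alpha>2 \<beta>1 :: 'a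
  proof -
    from that have "\<alpha>2 \<noteq> - (1/3)" "(3*\<alpha>1 - 1)^2 + 4*(3*\<alpha>2 + 1)*\<beta>1 \<noteq> 0"
      unfolding third_iff by auto
    thus ?thesis by (simp only: A1_quadratic simp_thms if_False)
  qed
  note quadratic = this
  show ?thesis
    using assms unfolding three_list_def
  proof (elim UnE)
  qed (elim CollectE exE conjE singletonE, hypsubst,
      simp only: quadratic A1_cubic(1) A2_cubic(1) A3_card A6_cubic(1) A7_card A11_card
        simp_thms if_True if_False)+
qed

lemma infinite_infinite_list:
  assumes "A \<in> (infinite_list :: ('a^4^2) set)"
  shows "infinite (proj_roots A)"
proof -
  have "3 * (1/3) - 1 = (0::'a)" using third_iff(1) by blast
  hence "msc_cubic (A8 (1/3)) y = (0::'a)" for y by (simp only: msc_cubic_families mult_zero_left add_0)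
  moreover have "msc_cubic (A4 \<alpha>1 (2*\<alpha>1 - 1)) y = (0::'a)" for \<alpha>1 y by (simp add: msc_cubic_families)
  moreover have "msc_cubic (A1 (1/3) (- (1/3)) 0 0) y = (0::'a)" for y by (simp only: A1_flat minus_zero)
  ultimately have "msc_cubic A y = 0" for y
    using assms unfolding infinite_list_def by blast
  thus ?thesis by (rule infinite_proj_roots)
qed

section \<open>Exhaustiveness of the lists\<close>

text \<open>Case distinction by the degree of the cubic. In degree three with coinciding critical
  points, \<open>P = 0\<close> forces the value of \<open>\<beta>1\<close> required in the first
  list, and otherwise the third list applies.\<close>

lemma A1_covered:
  "A1 \<alpha>1 \<alpha>2 \<alpha>4 \<beta>1 \<in> one_list \<union> two_list rt \<union> three_list rt \<union> infinite_list" (is "?A \<in> ?L")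
proof (cases "\<alpha>4 = 0")
  case False
  let ?P = "msc_cubic ?A (y_m1 rt \<alpha>1 \<alpha>2 \<alpha>4) * msc_cubic ?A (y_p1 rt \<alpha>1 \<alpha>2 \<alpha>4)"
  have triple: "?A \<in> one_list"
    if "\<alpha>1 = (3*\<alpha>2 + 1)^2 / (9*\<alpha>4) + 1/3" "\<beta>1 = - ((3*\<alpha>2 + 1)^3) / (27*\<alpha>4^2)"
    using False that unfolding one_list_def by blast
  have double: "?A \<in> two_list rt" if "\<alpha>1 \<noteq> (3*\<alpha>2 + 1)^2 / (9*\<alpha>4) + 1/3" "?P = 0"
    using False that unfolding two_list_def by blast
  have "?A \<in> three_list rt" if "?P \<noteq> 0"
    using False that unfolding three_list_def by blast
  with triple double show ?thesis
    using A1_cubic(2)[OF False, of \<alpha>1 \<alpha>2 \<beta>1] by (meson UnI1 UnI2)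
next
  case True
  consider "3*\<alpha>2 + 1 \<noteq> 0" | "\<alpha>2 = - (1/3)" "\<alpha>1 \<noteq> 1/3" | "\<alpha>2 = - (1/3)" "\<alpha>1 = 1/3"
    using third_iff by blast
  thus ?thesis
  proof cases
    case 1
    hence "\<alpha>2 \<noteq> - (1/3)" using third_iff by blast
    hence "?A \<in> two_list rt" if "(3*\<alpha>1 - 1)^2 + 4*(3*\<alpha>2 + 1)*\<beta>1 = 0"
      using that True unfolding two_list_def by blast
    moreover have "?A \<in> three_list rt" if "(3*\<alpha>1 - 1)^2 + 4*(3*\<alpha>2 + 1)*\<beta>1 \<noteq> 0"
      using that 1 True no_zero_divisors[OF 1 that] unfolding three_list_def by blast
    ultimately show ?thesis by blast
  next
    case 2
    thus ?thesis using True unfolding two_list_def by blast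
  next
    case 3
    hence "?A \<in> one_list" if "\<beta>1 \<noteq> 0"
      using True that unfolding one_list_def by blast
    moreover have "?A \<in> infinite_list" if "\<beta>1 = 0"
      using True 3 that unfolding infinite_list_def by blast
    ultimately show ?thesis by blast
  qed
qed

lemma A2_covered:
  "A2 \<alpha>1 \<beta>1 \<beta>2 \<in> one_list \<union> two_list rt \<union> three_list rt" (is "?A \<in> _")
proof -
  let ?P = "msc_cubic ?A (y_m2 rt \<alpha>1 \<beta>2) * msc_cubic ?A (y_p2 rt \<alpha>1 \<beta>2)"
  have triple: "?A \<in> one_list" if "\<beta>2 = 2*\<alpha>1 - 1" "\<beta>1 = 0"
    using that unfolding one_list_def by blast
  have double: "?A \<in> two_list rt" if "\<beta>2 \<noteq> 2*\<alpha>1 - 1" "?P = 0"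
    using that unfolding two_list_def by blast
  have "?A \<in> three_list rt" if "?P \<noteq> 0"
    using that unfolding three_list_def by blast
  with triple double show ?thesis
    using A2_cubic(2)[of \<beta>2 \<alpha>1 \<beta>1] by (meson UnI1 UnI2)
qed

lemma A6_covered:
  "A6 \<alpha>1 \<beta>1 \<in> one_list \<union> two_list rt \<union> three_list rt" (is "?A \<in> _")
proof -
  let ?P = "msc_cubic ?A (y_m6 rt \<alpha>1) * msc_cubic ?A (y_p6 rt \<alpha>1)"
  have triple: "?A \<in> one_list" if "\<alpha>1 = 1/3" "\<beta>1 = 0"
    using that unfolding one_list_def by blast
  have double: "?A \<in> two_list rt" if "\<alpha>1 \<noteq> 1/3" "?P = 0"
    using that unfolding two_list_def by blast
  have "?A \<in> three_list rt" if "?P \<noteq> 0"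
    using that unfolding three_list_def by blast
  with triple double show ?thesis
    using A6_cubic(2)[of \<alpha>1 \<beta>1] by (meson UnI1 UnI2)
qed

lemma families_covered: "families \<subseteq> one_list \<union> two_list rt \<union> three_list rt \<union> infinite_list"
proof -
  let ?L = "one_list \<union> two_list rt \<union> three_list rt \<union> infinite_list"
  have 3: "A3 \<beta>1 \<beta>2 \<in> ?L" for \<beta>1 \<beta>2
  proof (cases "(\<beta>2 + 1)^2 + 12*\<beta>1 = 0")
    case True
    hence "\<beta>1 = - ((\<beta>2 + 1)^2 / 12)" using twelfth_iff by blast
    thus ?thesis unfolding two_list_def by blast
  next
    case False
    thus ?thesis unfolding three_list_def by blast
  qed
  have 4: "A4 \<alpha>1 \<beta>2 \<in> ?L" for \<alpha>1 \<beta>2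
    by (cases "\<beta>2 = 2*\<alpha>1 - 1") (unfold two_list_def infinite_list_def, blast+)
  have 5: "A5 \<alpha>1 \<in> ?L" for \<alpha>1
    unfolding one_list_def by blast
  have 7: "A7 \<beta>1 \<in> ?L" for \<beta>1
  proof (cases "12*\<beta>1 + 1 = 0")
    case True
    hence "\<beta>1 = - (1 / 12)" using twelfth_iff[of \<beta>1 1] by (simp only: add.commute)
    thus ?thesis unfolding two_list_def by blast
  next
    case False
    thus ?thesis unfolding three_list_def by blast
  qed
  have 8: "A8 \<alpha>1 \<in> ?L" for \<alpha>1
    by (cases "\<alpha>1 = 1/3") (unfold two_list_def infinite_list_def, blast+)
  have 9: "A9 \<in> ?L" "A10 \<in> ?L" "A11 \<in> ?L" "A12 \<in> ?L"
    unfolding one_list_def two_list_def three_list_def by blast+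
  have 2: "A2 \<alpha>1 \<beta>1 \<beta>2 \<in> ?L" for \<alpha>1 \<beta>1 \<beta>2 using A2_covered by (rule UnI1)
  have 6: "A6 \<alpha>1 \<beta>1 \<in> ?L" for \<alpha>1 \<beta>1 using A6_covered by (rule UnI1)
  show ?thesis
    unfolding families_def
  proof (intro Un_least subsetI)
  qed ((elim CollectE exE conjE insertE emptyE)?, hypsubst,
      simp only: A1_covered 2 3 4 5 6 7 8 9)+
qed

end

section \<open>Assembly of the classification\<close>

theorem theorem3p3:
  fixes smul :: "'a::field \<Rightarrow> 'v::ab_group_add \<Rightarrow> 'v"
    and mul :: "'v \<Rightarrow> 'v \<Rightarrow> 'v"
    and rt :: "'a \<Rightarrow> 'a"
  assumes char: "CHAR('a) \<noteq> 2" "CHAR('a) \<noteq> 3"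
    and roots: "\<And>p :: 'a poly. degree p = 2 \<or> degree p = 3 \<Longrightarrow> \<exists>x. poly p x = 0"
    and rt: "\<And>z. rt z ^ 2 = z"
    and alg: "two_dim_algebra smul mul"
    and nontriv: "nonassoc_algebra.nontrivial mul"
  shows "let S = two_dim_algebra.nontrivial_subalgebras smul mul in
           (card S = 1 \<or> card S = 2 \<or> card S = 3 \<or> infinite S) \<and>
           (card S = 1 \<longleftrightarrow> isomorphic_to_one_of smul mul one_list) \<and>
           (card S = 2 \<longleftrightarrow> isomorphic_to_one_of smul mul (two_list rt)) \<and>
           (card S = 3 \<longleftrightarrow> isomorphic_to_one_of smul mul (three_list rt)) \<and>
           (infinite S \<longleftrightarrow> isomorphic_to_one_of smul mul infinite_list)"
proof -
  \<comment> \<open>If a prime vanishes in the field, the characteristic divides it, hence is 1 or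
    the prime itself; it is never 1.\<close>
  have prime_ne: "of_nat p \<noteq> (0::'a)" if "prime p" "CHAR('a) \<noteq> p" for p
  proof
    assume "of_nat p = (0::'a)"
    hence "CHAR('a) dvd p" by (simp add: of_nat_eq_0_iff_char_dvd)
    hence "CHAR('a) = 1" using that unfolding prime_nat_iff by blast
    thus False by simp
  qed
  have "root_closed_field rt"
  proof
    show "(2::'a) \<noteq> 0" "(3::'a) \<noteq> 0"
      using prime_ne[of 2] prime_ne[of 3] char two_is_prime_nat by (simp_all)
    show "\<exists>y. a * y^3 + b * y^2 + c * y + d = 0" if "a \<noteq> 0" for a b c d :: 'a
    proof -
      have "degree [:d, c, b, a:] = 3" using that by simp
      then obtain y where "poly [:d, c, b, a:] y = 0" using roots by blast
      hence "a * y^3 + b * y^2 + c * y + d = 0"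
        by (simp add: algebra_simps power2_eq_square power3_eq_cube)
      thus ?thesis by blast
    qed
  qed (rule rt)
  with alg interpret root_closed_algebra smul mul rt by (rule root_closed_algebra.intro)
  have iso: "isomorphic_to_one_of smul mul L \<longleftrightarrow> (\<exists>A\<in>L. admits A)" for L
    by (simp add: isomorphic_to_one_of_def algebra_isomorphic_iff_has_msc admits_def)
  have card: "card nontrivial_subalgebras = card (proj_roots A)"
    and fin: "finite nontrivial_subalgebras \<longleftrightarrow> finite (proj_roots A)" if "admits A" for A
    using that card_nontrivial_subalgebras unfolding admits_def by blast+
  have 1: "card nontrivial_subalgebras = 1" if "isomorphic_to_one_of smul mul one_list"
    using that card card_one_list unfolding iso by metis
  have 2: "card nontrivial_subalgebras = 2" if "isomorphic_to_one_of smul mul (two_list rt)"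
    using that card card_two_list unfolding iso by metis
  have 3: "card nontrivial_subalgebras = 3" if "isomorphic_to_one_of smul mul (three_list rt)"
    using that card card_three_list unfolding iso by metis
  have 4: "infinite nontrivial_subalgebras" if "isomorphic_to_one_of smul mul infinite_list"
    using that fin infinite_infinite_list unfolding iso by metis
  obtain A where "admits A" using has_msc_exists unfolding admits_def by blast
  then obtain B where "B \<in> families" "admits B"
    using admits_families[OF nontriv] by blast
  hence "isomorphic_to_one_of smul mul one_list \<or> isomorphic_to_one_of smul mul (two_list rt) \<or>
      isomorphic_to_one_of smul mul (three_list rt) \<or> isomorphic_to_one_of smul mul infinite_list"
    unfolding iso using families_covered by blast
  \<comment> \<open>Infinite sets have \<open>card\<close> 0, so the four outcomes exclude each
    other. As some list always applies, the implications from lists to numbers become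
    equivalences.\<close>
  moreover have "card nontrivial_subalgebras = 0" if "isomorphic_to_one_of smul mul infinite_list"
    using 4[OF that] by simp
  ultimately show ?thesis
    unfolding Let_def using 1 2 3 4
    by (elim disjE) (fastforce intro: card_ge_0_finite)+
qed

end
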